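(* Let $K$ be a Galois number field, let $\varepsilon>0$, let $k\in\mathbb{Z}^+$, and let $a\in\mathcal{O}_K\setminus\{0\}$ be a non-zero algebraic integer of $K$ that is not a root of unity. Assume the $abc$ conjecture holds in $K$. Then the number of non-Wieferich places $\mathfrak{p}$ base $a$ with $\mathrm{Nm}(\mathfrak{p})\le x$ and $\mathrm{Nm}(\mathfrak{p})\equiv 1 \pmod{k}$ is $\gg_{\varepsilon,K,a,k} \log x/\log\log x$.
   Context: $\mathcal{O}_K$ is the ring of integers of $K$, and $\mathrm{Nm}(\mathfrak{p})$ is the absolute norm of a prime ideal $\mathfrak{p}$. For a prime ideal $\mathfrak{p}$ and an ideal $I$, $v_{\mathfrak{p}}(I)$ is the exponent of $\mathfrak{p}$ in $I$, and $v_{\mathfrak{p}}(x)=v_{\mathfrak{p}}((x))$. For $a\in\mathcal{O}_K\setminus\{0\}$ and a prime ideal $\mathfrak{p}$ with $q=\mathrm{Nm}(\mathfrak{p})$: $\mathfrak{p}$ is a Wieferich place base $a$ if $v_{\mathfrak{p}}(a^{q-1}-1)>1$, and a non-Wieferich place base $a$ if $v_{\mathfrak{p}}(a^{q-1}-1)=1$. The $abc$ conjecture for $K$: for $a_1,a_2,a_3\in K^\times$ define the height $H(a_1,a_2,a_3)=\prod_v \max(\|a_1\|_v,\|a_2\|_v,\|a_3\|_v)$, the product over the infinite places $v$ of $K$ with $\|a\|_v=|v(a)|^{1/[K:\mathbb{Q}]}$, and the conductor $N(a_1,a_2,a_3)=\prod_{\mathfrak{p}\in I}\mathrm{Nm}(\mathfrak{p})^{1/[K:\mathbb{Q}]}$,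 where $I$ is the finite set of finite places $\mathfrak{p}$ at which the normalized absolute values $\|a_1\|_{\mathfrak{p}},\|a_2\|_{\mathfrak{p}},\|a_3\|_{\mathfrak{p}}$ are not all equal to $1$. The conjecture asserts: for every $\epsilon>0$ there is a constant $C(\epsilon,K)$ such that $H(\alpha,\beta,\alpha+\beta)\le C(\epsilon,K)\,N(\alpha,\beta,\alpha+\beta)^{1+\epsilon}$ for all $\alpha,\beta\in K$ with $\alpha,\beta,\alpha+\beta\neq 0$. Notation: $f(x)\gg_{S} g(x)$ means $f(x)\ge c\,g(x)$ for all sufficiently large $x$, for some constant $c>0$ depending only on the parameters in $S$.
   Formalization: As displayed, the abc inequality fails for every K (take α=β=2^m: height 2^(m+1), constant conductor); it is assumed here only for α, β in O_K with (α,β)=O_K, and the height is taken over all [K:Q] complex embeddings of K. *)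

theory Defs
  imports
    Complex_Main
    "HOL-Library.FuncSet"
    "HOL-Library.Extended_Nat"
    "HOL-Computational_Algebra.Polynomial"
    "HOL-Number_Theory.Cong"
    "HOL-Algebra.QuotRing"
    "HOL-Algebra.Divisibility"
    "HOL-Algebra.Ideal_Product"
    "HOL-Algebra.Subrings"
begin

text \<open>Number fields are subfields of the complex numbers of finite degree over the rationals.\<close>

definition cx_ring :: "complex set \<Rightarrow> complex ring" where
  "cx_ring A = \<lparr>carrier = A, mult = (*), one = 1, zero = 0, add = (+)\<rparr>"

global_interpretation cx_rat: vector_space "\<lambda>(q::rat) (z::complex). of_rat q * z"
  by unfold_locales (simp_all add: algebra_simps of_rat_add of_rat_mult)

definition number_field :: "complex set \<Rightarrow> bool" where
  "number_field K \<longleftrightarrow>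
     subfield K (cx_ring UNIV) \<and> (\<exists>B. finite B \<and> cx_rat.span B = K)"

definition nf_degree :: "complex set \<Rightarrow> nat" where
  "nf_degree K = cx_rat.dim K"

definition galois :: "complex set \<Rightarrow> bool" where
  "galois K \<longleftrightarrow>
     {x \<in> K. \<forall>\<sigma> \<in> ring_iso (cx_ring K) (cx_ring K). \<sigma> x = x} = \<rat>"

definition int_ring :: "complex set \<Rightarrow> complex ring" where
  "int_ring K = cx_ring {x \<in> K. algebraic_int x}"

definition finite_places :: "complex set \<Rightarrow> complex set set" where
  "finite_places K = {P. primeideal P (int_ring K) \<and> P \<noteq> {0}}"

definition ideal_norm :: "complex set \<Rightarrow> complex set \<Rightarrow> nat" where
  "ideal_norm K P = card (carrier (int_ring K Quot P))"

text \<open>The exponent of \<open>P\<close> in the ideal \<open>I\<close>, with value \<open>\<infinity>\<close> at the zero ideal.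
  Powers and divisibility are those of the multiplicative monoid of ideals.\<close>

definition ideal_exponent :: "complex set \<Rightarrow> complex set \<Rightarrow> complex set \<Rightarrow> enat" where
  "ideal_exponent K P I =
     (SUP n \<in> {n :: nat. (P [^]\<^bsub>ideals_set (int_ring K)\<^esub> n) divides\<^bsub>ideals_set (int_ring K)\<^esub> I}.
        enat n)"

definition int_val :: "complex set \<Rightarrow> complex set \<Rightarrow> complex \<Rightarrow> enat" where
  "int_val K P x = ideal_exponent K P (PIdl\<^bsub>int_ring K\<^esub> x)"

definition wieferich_place :: "complex set \<Rightarrow> complex \<Rightarrow> complex set \<Rightarrow> bool" where
  "wieferich_place K a P \<longleftrightarrow>
     P \<in> finite_places K \<and> int_val K P (a ^ (ideal_norm K P - 1) - 1) > 1"

definition non_wieferich_place :: "complex set \<Rightarrow> complex \<Rightarrow> complex set \<Rightarrow> bool" where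
  "non_wieferich_place K a P \<longleftrightarrow>
     P \<in> finite_places K \<and> int_val K P (a ^ (ideal_norm K P - 1) - 1) = 1"

text \<open>The valuation on the nonzero elements of \<open>K\<close>, each written as a quotient of two nonzero
  integers of \<open>K\<close>; the value does not depend on the quotient chosen.\<close>

definition field_val :: "complex set \<Rightarrow> complex set \<Rightarrow> complex \<Rightarrow> int" where
  "field_val K P z =
     (THE m. \<exists>x \<in> carrier (int_ring K). \<exists>y \<in> carrier (int_ring K).
        x \<noteq> 0 \<and> y \<noteq> 0 \<and> z = x / y \<and>
        m = int (the_enat (int_val K P x)) - int (the_enat (int_val K P y)))"

definition finite_abs :: "complex set \<Rightarrow> complex set \<Rightarrow> complex \<Rightarrow> real" where
  "finite_abs K P z =
     real (ideal_norm K P) powr (- of_int (field_val K P z) / real (nf_degree K))"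

text \<open>Embeddings are taken extensional, so that they are determined by their values on \<open>K\<close>
  and there are exactly \<open>[K:Q]\<close> of them. A product over the infinite places, a complex place
  carrying its local degree 2, is a product over the embeddings.\<close>

definition embeddings :: "complex set \<Rightarrow> (complex \<Rightarrow> complex) set" where
  "embeddings K = ring_hom (cx_ring K) (cx_ring UNIV) \<inter> extensional K"

definition infinite_abs :: "complex set \<Rightarrow> (complex \<Rightarrow> complex) \<Rightarrow> complex \<Rightarrow> real" where
  "infinite_abs K \<sigma> z = cmod (\<sigma> z) powr (1 / real (nf_degree K))"

definition height :: "complex set \<Rightarrow> complex \<Rightarrow> complex \<Rightarrow> complex \<Rightarrow> real" where
  "height K a1 a2 a3 =
     (\<Prod>\<sigma> \<in> embeddings K.
        max (infinite_abs K \<sigma> a1) (max (infinite_abs K \<sigma> a2) (infinite_abs K \<sigma> a3)))"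

definition conductor :: "complex set \<Rightarrow> complex \<Rightarrow> complex \<Rightarrow> complex \<Rightarrow> real" where
  "conductor K a1 a2 a3 =
     (\<Prod>P \<in> {P \<in> finite_places K.
               \<not> (finite_abs K P a1 = 1 \<and> finite_abs K P a2 = 1 \<and> finite_abs K P a3 = 1)}.
        real (ideal_norm K P) powr (1 / real (nf_degree K)))"

definition coprime_ints :: "complex set \<Rightarrow> complex \<Rightarrow> complex \<Rightarrow> bool" where
  "coprime_ints K x y \<longleftrightarrow>
     x \<in> carrier (int_ring K) \<and> y \<in> carrier (int_ring K) \<and>
     Idl\<^bsub>int_ring K\<^esub> {x, y} = carrier (int_ring K)"

text \<open>A height with infinite places only goes with coprime integers, for which every finite place
  would contribute the factor 1. Without coprimality the inequality is false over every \<open>K\<close>: for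
  \<open>\<alpha> = \<beta> = 2 ^ m\<close> the height is \<open>2 ^ (m + 1)\<close> while the conductor does not depend on
  \<open>m \<ge> 1\<close>. So this is a consequence of the conjecture with heights over all places, and it is
  the weakest of these hypotheses.\<close>

definition abc_conjecture :: "complex set \<Rightarrow> bool" where
  "abc_conjecture K \<longleftrightarrow>
     (\<forall>\<epsilon> > 0. \<exists>C. \<forall>\<alpha> \<in> K. \<forall>\<beta> \<in> K.
        \<alpha> \<noteq> 0 \<longrightarrow> \<beta> \<noteq> 0 \<longrightarrow> \<alpha> + \<beta> \<noteq> 0 \<longrightarrow> coprime_ints K \<alpha> \<beta> \<longrightarrow>
        height K \<alpha> \<beta> (\<alpha> + \<beta>) \<le> C * conductor K \<alpha> \<beta> (\<alpha> + \<beta>) powr (1 + \<epsilon>))"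

end

theory Submission
  imports
    Defs
    "Jordan_Normal_Form.Char_Poly"
    "HOL-Real_Asymp.Real_Asymp"
begin

text \<open>Write \<open>x\<^sub>n = a ^ n - 1\<close> and let \<open>M\<close> be the product of \<open>max 1 \<bar>\<sigma> a\<bar>\<close> over all embeddings
  \<open>\<sigma>\<close>; \<open>M > 1\<close> since \<open>a\<close> is not a root of unity. Let \<open>R\<close> and \<open>Q\<close> be the products of the norms of the
  primes dividing \<open>x\<^sub>n\<close> exactly once and more than once. Up to constants \<open>R Q\<^sup>2\<close> is at most \<open>M\<^sup>n\<close>,
  and \<open>M\<^sup>n\<close> is at most \<open>(R Q) powr (4/3)\<close> by the \<open>abc\<close> inequality for \<open>x\<^sub>n + 1 = a ^ n\<close>; so \<open>R\<close> is
  at least \<open>M powr (n/2)\<close>. Take \<open>n = k ^ N * q\<close> with a large prime \<open>q\<close>. A prime of \<open>x\<^sub>n\<close> modulo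
  which the order of \<open>a\<close> is not divisible by \<open>k * q\<close> divides \<open>x\<^sub>m\<close> for \<open>m = k ^ N\<close> or
  \<open>m = n / l ^ N\<close> with a prime divisor \<open>l\<close> of \<open>k\<close>, and together these contribute at most
  \<open>M powr (n/4)\<close> to \<open>R\<close>. Hence some prime dividing \<open>x\<^sub>n\<close> exactly once has order divisible by
  \<open>k * q\<close>; it is non-Wieferich, its norm is 1 modulo \<open>k\<close>, and it determines \<open>q\<close>. Chebyshev's
  lower bound for the number of primes \<open>q\<close> finishes the proof.

  The arithmetic of the ring of integers is obtained without discriminants or determinants of
  lattices: indices of principal ideals are bounded by counting integers with bounded conjugates.\<close>

section \<open>Algebraic integers\<close>

text \<open>Everything is read off from the order of \<open>a\<close> modulo \<open>P\<close>. It
  divides \<open>ideal_norm K P - 1\<close>, so a factor \<open>k\<close> of the order gives the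
  congruence; it divides \<open>k ^ N * q\<close>, so a prime factor larger than \<open>k\<close>
  can only be \<open>q\<close>. The obstacle is to produce such an order without cyclotomic
  polynomials. With exponent \<open>k * q\<close> and \<open>k\<close> even, the primes dividing
  \<open>a ^ (n div 2) - 1\<close> might already use up the lower bound \<open>M powr (n/2)\<close>.
  With \<open>k ^ N\<close> a missing factor of \<open>k\<close> costs \<open>l ^ N\<close> instead
  of \<open>l\<close>; there are at most \<open>k\<close> primes \<open>l\<close>, and
  \<open>N = k + 2\<close> makes \<open>k / 2 ^ N\<close> at most 1/4. The exponent 4/3 is the
  conjecture for 1/3. Let \<open>A\<close>, \<open>B\<close>, \<open>h\<close> be the logarithms of
  \<open>R\<close>, \<open>Q\<close>, \<open>M ^ n\<close>. Up to constants \<open>A + 2 * B\<close>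
  is at most \<open>h\<close> and \<open>A + B\<close> at least \<open>3/4 * h\<close>, so
  \<open>A = 2 * (A + B) - (A + 2 * B)\<close> is at least \<open>h / 2\<close>, twice what the
  small orders take away. The place found for \<open>q\<close> has norm at most
  \<open>exp (c * q)\<close>, so all large primes \<open>q\<close> up to \<open>ln x / c\<close>
  contribute: this is the origin of \<open>ln x / ln (ln x)\<close>.\<close>

global_interpretation cx_int: Modules.module "\<lambda>(n::int) (z::complex). of_int n * z"
  by unfold_locales (simp_all add: algebra_simps)

text \<open>Multiplication by \<open>x\<close> on the span of \<open>B\<close> is described by an
  integer matrix, and the vector listing \<open>B\<close> is an eigenvector of it for
  \<open>x\<close>. So \<open>x\<close> is a root of its characteristic polynomial, which is monic
  with integer coefficients.\<close>

lemma algebraic_int_of_stable_span: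
  fixes B :: "complex set"
  assumes fin: "finite B" and nz: "\<not> B \<subseteq> {0}"
    and stable: "\<And>b. b \<in> B \<Longrightarrow> x * b \<in> cx_int.span B"
  shows "algebraic_int x"
proof -
  define n where "n = card B"
  obtain h where h: "bij_betw h {0..<n} B"
    using ex_bij_betw_nat_finite[OF fin] n_def by blast
  have "\<exists>c. x * b = (\<Sum>v\<in>B. of_int (c v) * v)" if "b \<in> B" for b
    using stable[OF that] unfolding cx_int.span_finite[OF fin] by blast
  then obtain c where c: "\<And>b. b \<in> B \<Longrightarrow> x * b = (\<Sum>v\<in>B. of_int (c b v) * v)" by metis
  define A :: "int mat" where "A = mat n n (\<lambda>(i,j). c (h i) (h j))"
  have A: "A \<in> carrier_mat n n" by (simp add: A_def)
  let ?A = "of_int_hom.mat_hom A :: complex mat"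
  have A': "?A \<in> carrier_mat n n" using A by simp
  define v where "v = vec n h"
  have v: "v \<in> carrier_vec n" by (simp add: v_def)
  obtain b where "b \<in> B" "b \<noteq> 0" using nz by blast
  then obtain i where i: "i < n" "h i \<noteq> 0"
    using h by (metis atLeastLessThan_iff bij_betw_iff_bijections)
  then have v0: "v \<noteq> 0\<^sub>v n" by (metis index_vec index_zero_vec(1) v_def)
  have "?A *\<^sub>v v = x \<cdot>\<^sub>v v"
  proof (rule eq_vecI)
    fix i assume "i < dim_vec (x \<cdot>\<^sub>v v)"
    then have i: "i < n" by (simp add: v_def)
    then have hi: "h i \<in> B" using h by (auto simp: bij_betw_def)
    have "(?A *\<^sub>v v) $ i = (\<Sum>j\<in>{0..<n}. of_int (c (h i) (h j)) * h j)"
      using i A by (simp add: scalar_prod_def A_def v_def)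
    also have "\<dots> = (\<Sum>w\<in>B. of_int (c (h i) w) * w)"
      by (rule sum.reindex_bij_betw[OF h])
    also have "\<dots> = x * h i" using c[OF hi] by simp
    finally show "(?A *\<^sub>v v) $ i = (x \<cdot>\<^sub>v v) $ i" using i by (simp add: v_def)
  qed (simp add: v_def A_def)
  then have "eigenvalue ?A x"
    unfolding eigenvalue_def eigenvector_def using v v0 A' by auto
  then have "poly (char_poly ?A) x = 0" using eigenvalue_root_char_poly[OF A'] by simp
  then have "poly (of_int_poly (char_poly A)) x = 0" using of_int_hom.char_poly_hom[OF A] by metis
  moreover have "lead_coeff (char_poly A) = 1" using degree_monic_char_poly[OF A] by simp
  ultimately show ?thesis using algebraic_int_altdef_ipoly by blast
qed

lemma algebraic_int_power_in_span:
  fixes x :: complex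
  assumes "algebraic_int x"
  obtains n where "n > 0" "x ^ n \<in> cx_int.span ((\<lambda>i. x ^ i) ` {..<n})"
proof -
  obtain p where p: "poly (map_poly of_int p) x = 0" "lead_coeff p = 1"
    using assms algebraic_int_altdef_ipoly by blast
  define n where "n = degree p"
  have "n > 0"
  proof (rule ccontr)
    assume "\<not> n > 0"
    then obtain a where "p = [:a:]" by (metis degree_eq_zeroE gr0I n_def)
    then show False using p by simp
  qed
  have "0 = (\<Sum>i\<le>n. of_int (poly.coeff p i) * x ^ i)"
    using p(1) by (simp add: poly_altdef n_def degree_map_poly)
  also have "\<dots> = (\<Sum>i<n. of_int (poly.coeff p i) * x ^ i) + x ^ n"
    using p(2) by (simp add: lessThan_Suc_atMost[symmetric] n_def)
  finally have "x ^ n = (\<Sum>i<n. of_int (- poly.coeff p i) * x ^ i)"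
    by (simp add: sum_negf add_eq_0_iff)
  also have "\<dots> \<in> cx_int.span ((\<lambda>i. x ^ i) ` {..<n})"
    by (intro cx_int.span_sum cx_int.span_scale cx_int.span_base) auto
  finally show ?thesis using that \<open>n > 0\<close> by blast
qed

lemma span_mult_image:
  assumes "z \<in> cx_int.span S"
  shows "w * z \<in> cx_int.span ((\<lambda>s. w * s) ` S)"
  using assms
proof (induction rule: cx_int.span_induct_alt)
  case base
  then show ?case by (simp add: cx_int.span_zero)
next
  case (step c s z)
  have "w * (of_int c * s + z) = of_int c * (w * s) + w * z" by (simp add: algebra_simps)
  then show ?case using step
    by (metis cx_int.span_add cx_int.span_base cx_int.span_scale image_eqI)
qed

text \<open>A lattice stable under both numbers is stable under their sum and product. The monomials
  below the two degrees span one, because \<open>x ^ m\<close> and \<open>y ^ n\<close> reduce to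
  lower powers.\<close>

lemma algebraic_int_stable_lattice:
  fixes x y :: complex
  assumes "algebraic_int x" "algebraic_int y"
  obtains B where "finite B" "1 \<in> B"
    "\<And>b. b \<in> B \<Longrightarrow> x * b \<in> cx_int.span B" "\<And>b. b \<in> B \<Longrightarrow> y * b \<in> cx_int.span B"
proof -
  obtain m where m: "m > 0" "x ^ m \<in> cx_int.span ((\<lambda>i. x ^ i) ` {..<m})"
    using algebraic_int_power_in_span[OF assms(1)] .
  obtain n where n: "n > 0" "y ^ n \<in> cx_int.span ((\<lambda>i. y ^ i) ` {..<n})"
    using algebraic_int_power_in_span[OF assms(2)] .
  define B where "B = (\<lambda>(i,j). x ^ i * y ^ j) ` ({..<m} \<times> {..<n})"
  have B: "x ^ i * y ^ j \<in> B" if "i < m" "j < n" for i j using that by (auto simp: B_def)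
  show ?thesis
  proof
    show "finite B" by (simp add: B_def)
    show "1 \<in> B" using B[of 0 0] m n by simp
  next
    fix b assume "b \<in> B"
    then obtain i j where ij: "i < m" "j < n" "b = x ^ i * y ^ j" by (auto simp: B_def)
    show "x * b \<in> cx_int.span B"
    proof (cases "Suc i < m")
      case True
      then show ?thesis using cx_int.span_base[OF B[of "Suc i" j]] ij by (simp add: mult_ac)
    next
      case False
      then have "m = Suc i" using ij by simp
      then have "x * b = y ^ j * x ^ m" using ij by (simp add: mult_ac)
      also have "\<dots> \<in> cx_int.span ((\<lambda>s. y ^ j * s) ` (\<lambda>i. x ^ i) ` {..<m})"
        by (rule span_mult_image[OF m(2)])
      also have "\<dots> \<subseteq> cx_int.span B"
        by (rule cx_int.span_mono) (use B ij in \<open>auto simp: mult.commute\<close>)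
      finally show ?thesis .
    qed
    show "y * b \<in> cx_int.span B"
    proof (cases "Suc j < n")
      case True
      then show ?thesis using cx_int.span_base[OF B[of i "Suc j"]] ij by (simp add: mult_ac)
    next
      case False
      then have "n = Suc j" using ij by simp
      then have "y * b = x ^ i * y ^ n" using ij by (simp add: mult_ac)
      also have "\<dots> \<in> cx_int.span ((\<lambda>s. x ^ i * s) ` (\<lambda>i. y ^ i) ` {..<n})"
        by (rule span_mult_image[OF n(2)])
      also have "\<dots> \<subseteq> cx_int.span B"
        by (rule cx_int.span_mono) (use B ij in \<open>auto simp: mult.commute\<close>)
      finally show ?thesis .
    qed
  qed
qed

lemma algebraic_int_add_cx:
  fixes x y :: complex
  assumes "algebraic_int x" "algebraic_int y"
  shows "algebraic_int (x + y)"
proof -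
  obtain B where B: "finite B" "1 \<in> B"
    "\<And>b. b \<in> B \<Longrightarrow> x * b \<in> cx_int.span B" "\<And>b. b \<in> B \<Longrightarrow> y * b \<in> cx_int.span B"
    using algebraic_int_stable_lattice[OF assms] by metis
  show ?thesis
    by (rule algebraic_int_of_stable_span[OF B(1)])
      (use B in \<open>auto simp: distrib_right intro: cx_int.span_add\<close>)
qed

lemma algebraic_int_mult_cx:
  fixes x y :: complex
  assumes "algebraic_int x" "algebraic_int y"
  shows "algebraic_int (x * y)"
proof -
  obtain B where B: "finite B" "1 \<in> B"
    "\<And>b. b \<in> B \<Longrightarrow> x * b \<in> cx_int.span B" "\<And>b. b \<in> B \<Longrightarrow> y * b \<in> cx_int.span B"
    using algebraic_int_stable_lattice[OF assms] by metis
  have "x * z \<in> cx_int.span B" if "z \<in> cx_int.span B" for z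
    using that
  proof (induction rule: cx_int.span_induct_alt)
    case base
    then show ?case by (simp add: cx_int.span_zero)
  next
    case (step c s z)
    have "x * (of_int c * s + z) = of_int c * (x * s) + x * z" by (simp add: algebra_simps)
    then show ?case using step B(3) by (metis cx_int.span_add cx_int.span_scale)
  qed
  then show ?thesis
    by (intro algebraic_int_of_stable_span[OF B(1)]) (use B in \<open>auto simp: mult.assoc\<close>)
qed

section \<open>Embeddings of a Galois number field\<close>

lemma cx_ring_simps [simp]:
  "carrier (cx_ring A) = A" "mult (cx_ring A) = (*)" "one (cx_ring A) = 1"
  "zero (cx_ring A) = 0" "add (cx_ring A) = (+)"
  by (simp_all add: cx_ring_def)

definition nf_ints :: "complex set \<Rightarrow> complex set" where
  "nf_ints K = {x \<in> K. algebraic_int x}"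

lemma int_ring_simps [simp]:
  "carrier (int_ring K) = nf_ints K" "mult (int_ring K) = (*)" "one (int_ring K) = 1"
  "zero (int_ring K) = 0" "add (int_ring K) = (+)"
  by (simp_all add: int_ring_def nf_ints_def)

locale galois_field =
  fixes K :: "complex set"
  assumes number_field: "number_field K" and galois: "galois K"
begin

lemma subfield: "subfield K (cx_ring UNIV)"
  using number_field by (simp add: number_field_def)

lemma rat_spanned: "\<exists>B. finite B \<and> cx_rat.span B = K"
  using number_field by (simp add: number_field_def)

lemma K_add: "x \<in> K \<Longrightarrow> y \<in> K \<Longrightarrow> x + y \<in> K"
  using rat_spanned cx_rat.span_add by blast

lemma K_scale: "x \<in> K \<Longrightarrow> of_rat q * x \<in> K"
  using rat_spanned cx_rat.span_scale by blast

lemma K_zero: "0 \<in> K"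
  using rat_spanned cx_rat.span_zero by blast

lemma submonoid_K: "submonoid K (cx_ring UNIV)"
  using subfield unfolding subfield_def subdomain_def subcring_def subring_def by blast

lemma K_one: "1 \<in> K"
  using submonoid.one_closed[OF submonoid_K] by simp

lemma K_mult: "x \<in> K \<Longrightarrow> y \<in> K \<Longrightarrow> x * y \<in> K"
  using submonoid.m_closed[OF submonoid_K] by simp

lemma K_uminus: "x \<in> K \<Longrightarrow> - x \<in> K"
  using K_scale[of x "-1"] by simp

lemma K_diff: "x \<in> K \<Longrightarrow> y \<in> K \<Longrightarrow> x - y \<in> K"
  using K_add[of x "-y"] K_uminus by simp

lemma K_of_rat: "of_rat q \<in> K"
  using K_scale[OF K_one, of q] by simp

lemma K_of_int: "of_int n \<in> K"
  using K_of_rat[of "of_int n"] by simp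

lemma K_power: "x \<in> K \<Longrightarrow> x ^ n \<in> K"
  by (induction n) (auto simp: K_one K_mult)

lemma K_sum: "(\<And>i. i \<in> A \<Longrightarrow> f i \<in> K) \<Longrightarrow> sum f A \<in> K"
  by (induction A rule: infinite_finite_induct) (auto simp: K_zero K_add)

lemma K_prod: "(\<And>i. i \<in> A \<Longrightarrow> f i \<in> K) \<Longrightarrow> prod f A \<in> K"
  by (induction A rule: infinite_finite_induct) (auto simp: K_one K_mult)

lemma K_inverse:
  assumes "x \<in> K"
  shows "inverse x \<in> K"
proof (cases "x = 0")
  case False
  have "x \<in> Units (cx_ring UNIV \<lparr>carrier := K\<rparr>)"
    using subfield.subfield_Units[OF subfield] assms False by simp
  then obtain y where "y \<in> K" "y * x = 1" unfolding Units_def by auto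
  then show ?thesis using inverse_unique[of y x] by (metis inverse_unique mult.commute)
qed (simp add: K_zero)

lemma K_divide: "x \<in> K \<Longrightarrow> y \<in> K \<Longrightarrow> x / y \<in> K"
  using K_mult[of x "inverse y"] K_inverse by (simp add: divide_inverse)

abbreviation "OK \<equiv> nf_ints K"

lemma OK_K: "x \<in> OK \<Longrightarrow> x \<in> K"
  by (simp add: nf_ints_def)

lemma OK_add: "x \<in> OK \<Longrightarrow> y \<in> OK \<Longrightarrow> x + y \<in> OK"
  by (simp add: nf_ints_def K_add algebraic_int_add_cx)

lemma OK_mult: "x \<in> OK \<Longrightarrow> y \<in> OK \<Longrightarrow> x * y \<in> OK"
  by (simp add: nf_ints_def K_mult algebraic_int_mult_cx)

lemma OK_uminus: "x \<in> OK \<Longrightarrow> - x \<in> OK"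
  by (simp add: nf_ints_def K_uminus)

lemma OK_diff: "x \<in> OK \<Longrightarrow> y \<in> OK \<Longrightarrow> x - y \<in> OK"
  using OK_add[of x "-y"] OK_uminus by simp

lemma OK_of_int: "of_int n \<in> OK"
  by (simp add: nf_ints_def K_of_int int_imp_algebraic_int)

lemma OK_of_nat: "of_nat n \<in> OK"
  using OK_of_int[of "int n"] by simp

lemma OK_0: "0 \<in> OK" using OK_of_int[of 0] by simp

lemma OK_1: "1 \<in> OK" using OK_of_int[of 1] by simp

lemma OK_power: "x \<in> OK \<Longrightarrow> x ^ n \<in> OK"
  by (induction n) (auto simp: OK_1 OK_mult)

lemma OK_sum: "(\<And>i. i \<in> A \<Longrightarrow> f i \<in> OK) \<Longrightarrow> sum f A \<in> OK"
  by (induction A rule: infinite_finite_induct) (auto simp: OK_0 OK_add)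

lemma OK_prod: "(\<And>i. i \<in> A \<Longrightarrow> f i \<in> OK) \<Longrightarrow> prod f A \<in> OK"
  by (induction A rule: infinite_finite_induct) (auto simp: OK_1 OK_mult)

lemmas OK_closed = OK_add OK_mult OK_uminus OK_diff OK_of_int OK_of_nat OK_0 OK_1 OK_power OK_sum OK_prod

section \<open>Denominators and integral generators\<close>

lemma common_denominator:
  assumes "finite (S :: rat set)"
  shows "\<exists>D::int. D > 0 \<and> (\<forall>q\<in>S. of_int D * q \<in> \<int>)"
  using assms
proof induction
  case empty
  show ?case by (rule exI[of _ 1]) simp
next
  case (insert q S)
  then obtain D where D: "D > 0" "\<forall>q\<in>S. of_int D * q \<in> \<int>" by blast
  obtain m n where mn: "quotient_of q = (m, n)" by fastforce
  have n: "n > 0" "q = of_int m / of_int n"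
    using quotient_of_denom_pos[OF mn] quotient_of_div[OF mn] by auto
  show ?case
  proof (intro exI[of _ "D * n"] conjI ballI)
    fix r assume "r \<in> insert q S"
    then consider "r = q" | "r \<in> S" by blast
    then show "of_int (D * n) * r \<in> \<int>"
    proof cases
      case 1
      then have "of_int (D * n) * r = of_int (D * m)" using n by simp
      then show ?thesis by (metis Ints_of_int)
    next
      case 2
      then have "of_int D * r \<in> \<int>" using D by blast
      then have "of_int n * (of_int D * r) \<in> \<int>" by (rule Ints_mult[OF Ints_of_int])
      then show ?thesis by (simp only: of_int_mult mult_ac)
    qed
  qed (use D n in auto)
qed

text \<open>Multiplication by \<open>z\<close> acts on a finite rational spanning set of
  \<open>K\<close> through rational coefficients. Once \<open>D\<close> clears them,
  \<open>of_int D * z\<close> stabilises the integer span of the same set.\<close>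

lemma clear_denominator:
  assumes "z \<in> K"
  shows "\<exists>D::int. D > 0 \<and> of_int D * z \<in> OK"
proof -
  obtain B where B: "finite B" "cx_rat.span B = K" using rat_spanned by blast
  have "\<exists>c. z * b = (\<Sum>v\<in>B. of_rat (c v) * v)" if "b \<in> B" for b
  proof -
    have "b \<in> K" using that B cx_rat.span_base by blast
    then have "z * b \<in> cx_rat.span B" using K_mult assms B by simp
    then show ?thesis unfolding cx_rat.span_finite[OF B(1)] by blast
  qed
  then obtain c where c: "\<And>b. b \<in> B \<Longrightarrow> z * b = (\<Sum>v\<in>B. of_rat (c b v) * v)" by metis
  obtain D where D: "D > 0" "\<And>q. q \<in> (\<lambda>(b,v). c b v) ` (B \<times> B) \<Longrightarrow> of_int D * q \<in> \<int>"
    using common_denominator[of "(\<lambda>(b,v). c b v) ` (B \<times> B)"] B(1) by (metis finite_SigmaI finite_imageI)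
  have "\<not> B \<subseteq> {0}"
  proof
    assume "B \<subseteq> {0}"
    then have "cx_rat.span B \<subseteq> {0}"
      by (metis cx_rat.span_empty cx_rat.span_insert_0 cx_rat.span_mono)
    then show False using B K_one by auto
  qed
  moreover have "(of_int D * z) * b \<in> cx_int.span B" if "b \<in> B" for b
  proof -
    have "\<exists>n::int. of_int D * of_rat (c b v) = (of_int n :: complex)" if "v \<in> B" for v
    proof -
      have "of_int D * c b v \<in> \<int>" using D(2) \<open>b \<in> B\<close> that by blast
      then obtain n where "of_int D * c b v = of_int n" by (auto elim: Ints_cases)
      then have "(of_rat (of_int D * c b v) :: complex) = of_rat (of_int n)" by simp
      then show ?thesis by (auto simp: of_rat_mult)
    qed
    then obtain n where n: "\<And>v. v \<in> B \<Longrightarrow> of_int D * of_rat (c b v) = (of_int (n v) :: complex)"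
      by metis
    have "(of_int D * z) * b = of_int D * (\<Sum>v\<in>B. of_rat (c b v) * v)"
      using c[OF that] by (simp add: mult.assoc)
    also have "\<dots> = (\<Sum>v\<in>B. of_int (n v) * v)"
      unfolding sum_distrib_left by (intro sum.cong) (simp_all add: n flip: mult.assoc)
    also have "\<dots> \<in> cx_int.span B"
      by (intro cx_int.span_sum cx_int.span_scale cx_int.span_base)
    finally show ?thesis .
  qed
  ultimately have "algebraic_int (of_int D * z)"
    using algebraic_int_of_stable_span[OF B(1)] by blast
  then show ?thesis using D(1) K_mult K_of_int assms by (auto simp: nf_ints_def)
qed

lemma rat_spanned_by_ints:
  obtains B where "finite B" "B \<subseteq> OK"
    "\<And>z. z \<in> K \<Longrightarrow> \<exists>q. z = (\<Sum>b\<in>B. of_rat (q b) * b)"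
proof -
  obtain B where B: "finite B" "cx_rat.span B = K" using rat_spanned by blast
  then have "B \<subseteq> K" using cx_rat.span_superset by blast
  then have "\<forall>b\<in>B. \<exists>D::int. D > 0 \<and> of_int D * b \<in> OK" using clear_denominator by blast
  then obtain D where D: "\<And>b. b \<in> B \<Longrightarrow> D b > (0::int) \<and> of_int (D b) * b \<in> OK" by metis
  define B' where "B' = (\<lambda>b. of_int (D b) * b) ` B"
  have fin: "finite B'" using B by (simp add: B'_def)
  have "B \<subseteq> cx_rat.span B'"
  proof
    fix b assume b: "b \<in> B"
    have "of_rat (1 / of_int (D b)) * (of_int (D b) * b) \<in> cx_rat.span B'"
      by (intro cx_rat.span_scale cx_rat.span_base) (use b in \<open>auto simp: B'_def\<close>)
    then show "b \<in> cx_rat.span B'" using D[OF b] by (simp add: of_rat_divide)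
  qed
  then have "K \<subseteq> cx_rat.span B'" using B by (metis cx_rat.span_minimal cx_rat.subspace_span)
  then have "\<exists>q. z = (\<Sum>b\<in>B'. of_rat (q b) * b)" if "z \<in> K" for z
    using that unfolding cx_rat.span_finite[OF fin] by blast
  moreover have "B' \<subseteq> OK" using D by (auto simp: B'_def)
  ultimately show ?thesis using that fin by blast
qed

section \<open>Embeddings and their finiteness\<close>

abbreviation "E \<equiv> embeddings K"

lemma E_iff:
  "\<sigma> \<in> E \<longleftrightarrow> (\<forall>x\<in>K. \<forall>y\<in>K. \<sigma> (x * y) = \<sigma> x * \<sigma> y \<and> \<sigma> (x + y) = \<sigma> x + \<sigma> y) \<and> \<sigma> 1 = 1
     \<and> \<sigma> \<in> extensional K"
  by (auto simp: embeddings_def Ring.ring_hom_def)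

context
  fixes \<sigma> assumes \<sigma>: "\<sigma> \<in> E"
begin

lemma emb_add: "x \<in> K \<Longrightarrow> y \<in> K \<Longrightarrow> \<sigma> (x + y) = \<sigma> x + \<sigma> y"
  and emb_mult: "x \<in> K \<Longrightarrow> y \<in> K \<Longrightarrow> \<sigma> (x * y) = \<sigma> x * \<sigma> y"
  and emb_1: "\<sigma> 1 = 1"
  using \<sigma> by (simp_all add: E_iff)

lemma emb_0: "\<sigma> 0 = 0"
  using emb_add[of 0 0] K_zero by simp

lemma emb_uminus: "x \<in> K \<Longrightarrow> \<sigma> (- x) = - \<sigma> x"
  using emb_add[of x "-x"] K_uminus emb_0 by (simp add: add_eq_0_iff2 add_eq_0_iff)

lemma emb_diff: "x \<in> K \<Longrightarrow> y \<in> K \<Longrightarrow> \<sigma> (x - y) = \<sigma> x - \<sigma> y"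
  using emb_add[of x "-y"] K_uminus emb_uminus by simp

lemma emb_of_nat: "\<sigma> (of_nat n) = of_nat n"
  by (induction n) (use emb_0 emb_add[OF K_one] emb_1 K_of_int[of "int _"] in auto)

lemma emb_of_int: "\<sigma> (of_int n) = of_int n"
proof (cases n)
  case (nonneg m)
  then show ?thesis using emb_of_nat by simp
next
  case (neg m)
  then show ?thesis using emb_of_nat[of "Suc m"] emb_uminus[of "of_nat (Suc m)"] K_of_int[of "int (Suc m)"]
    by simp
qed

lemma emb_eq_0: "x \<in> K \<Longrightarrow> \<sigma> x = 0 \<longleftrightarrow> x = 0"
  using emb_mult[of x "inverse x"] emb_1 emb_0 K_inverse by (metis mult_zero_left right_inverse zero_neq_one)

lemma emb_of_rat: "\<sigma> (of_rat q) = of_rat q"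
proof -
  obtain m n where q: "q = of_int m / of_int n" "n > 0" by (cases q) (auto simp: Fract_of_int_quotient)
  have "\<sigma> (of_rat q) * of_int n = \<sigma> (of_rat q * of_int n)"
    by (subst emb_mult) (auto simp: K_of_rat K_of_int emb_of_int)
  also have "of_rat q * of_int n = (of_int m :: complex)" using q by (simp add: of_rat_divide)
  finally have "\<sigma> (of_rat q) * of_int n = of_int m" by (simp add: emb_of_int)
  moreover have "of_rat q = (of_int m / of_int n :: complex)" by (simp add: q(1) of_rat_divide)
  ultimately show ?thesis using q(2) by (metis nonzero_eq_divide_eq of_int_eq_0_iff less_irrefl)
qed

lemma emb_sum: "(\<And>i. i \<in> A \<Longrightarrow> f i \<in> K) \<Longrightarrow> \<sigma> (sum f A) = (\<Sum>i\<in>A. \<sigma> (f i))"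
  by (induction A rule: infinite_finite_induct) (auto simp: emb_0 emb_add K_sum)

lemma emb_power: "x \<in> K \<Longrightarrow> \<sigma> (x ^ n) = \<sigma> x ^ n"
  by (induction n) (auto simp: emb_1 emb_mult K_power)

lemma emb_poly: "x \<in> K \<Longrightarrow> poly (of_int_poly p) (\<sigma> x) = \<sigma> (poly (of_int_poly p) x)"
  by (simp add: poly_altdef emb_sum emb_mult emb_of_int emb_power K_mult K_of_int K_power)

lemma emb_algebraic_int: "x \<in> OK \<Longrightarrow> algebraic_int (\<sigma> x)"
  using algebraic_int_altdef_ipoly[of x] algebraic_int_altdef_ipoly[of "\<sigma> x"] emb_poly[of x] emb_0
  by (force simp: nf_ints_def)

end

lemma emb_prod: "\<sigma> \<in> E \<Longrightarrow> (\<And>i. i \<in> A \<Longrightarrow> f i \<in> K) \<Longrightarrow> \<sigma> (prod f A) = (\<Prod>i\<in>A. \<sigma> (f i))"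
  by (induction A rule: infinite_finite_induct) (auto simp: emb_1 emb_mult K_prod)

text \<open>An embedding is determined by the images of finitely many spanning integers, and each
  image is a root of a fixed monic integer polynomial. Extensionality fixes the values outside
  \<open>K\<close>.\<close>

lemma finite_E: "finite E"
proof -
  obtain B where B: "finite B" "B \<subseteq> OK" "\<And>z. z \<in> K \<Longrightarrow> \<exists>q. z = (\<Sum>b\<in>B. of_rat (q b) * b)"
    using rat_spanned_by_ints by metis
  then have BK: "b \<in> K" if "b \<in> B" for b using OK_K that by blast
  have "\<forall>b\<in>B. \<exists>p. poly (of_int_poly p) b = 0 \<and> lead_coeff p = 1"
    using B(2) algebraic_int_altdef_ipoly unfolding nf_ints_def by fastforce
  then obtain p where p: "\<And>b. b \<in> B \<Longrightarrow> poly (of_int_poly (p b)) b = 0 \<and> lead_coeff (p b) = 1"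
    by metis
  have "inj_on (\<lambda>\<sigma>. restrict \<sigma> B) E"
  proof (rule inj_onI)
    fix \<sigma> \<tau> assume st: "\<sigma> \<in> E" "\<tau> \<in> E" and eq: "restrict \<sigma> B = restrict \<tau> B"
    have "\<sigma> z = \<tau> z" for z
    proof (cases "z \<in> K")
      case True
      obtain q where z: "z = (\<Sum>b\<in>B. of_rat (q b) * b)" using B(3)[OF True] by blast
      have "\<rho> z = (\<Sum>b\<in>B. of_rat (q b) * \<rho> b)" if "\<rho> \<in> E" for \<rho>
        unfolding z using that BK
        by (simp add: emb_sum emb_mult emb_of_rat K_mult K_of_rat)
      moreover have "\<sigma> b = \<tau> b" if "b \<in> B" for b using eq that by (metis restrict_apply')
      ultimately show ?thesis using st sum.cong by (metis (no_types, lifting))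
    next
      case False
      then show ?thesis using st by (simp add: E_iff extensional_def)
    qed
    then show "\<sigma> = \<tau>" by blast
  qed
  moreover have "(\<lambda>\<sigma>. restrict \<sigma> B) ` E \<subseteq> (\<Pi>\<^sub>E b\<in>B. {z. poly (of_int_poly (p b)) z = 0})"
    using p BK by (auto simp: emb_poly emb_0)
  moreover have "finite (\<Pi>\<^sub>E b\<in>B. {z :: complex. poly (of_int_poly (p b)) z = 0})"
  proof (intro finite_PiE B(1) poly_roots_finite)
    fix b assume "b \<in> B"
    then have "p b \<noteq> 0" using p by force
    then show "of_int_poly (p b) \<noteq> (0 :: complex poly)" by simp
  qed
  ultimately show ?thesis by (meson finite_imageD finite_subset)
qed

lemma cnj_in_E: "\<sigma> \<in> E \<Longrightarrow> restrict (cnj \<circ> \<sigma>) K \<in> E"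
  unfolding E_iff by (auto simp: K_mult K_add K_one)

text \<open>The product of the conjugates of an integer is fixed by every automorphism, hence a
  rational integer. This is the only use of the Galois hypothesis.\<close>

lemma some_conjugate_ge_1:
  assumes "x \<in> OK" "x \<noteq> 0"
  shows "\<exists>\<sigma>\<in>E. cmod (\<sigma> x) \<ge> 1"
proof (rule ccontr)
  assume "\<not> ?thesis"
  then have small: "\<And>\<sigma>. \<sigma> \<in> E \<Longrightarrow> cmod (\<sigma> x) < 1" by force
  have xK: "x \<in> K" using assms OK_K by blast
  \<comment> \<open>The Galois group inside \<open>E\<close>: members of \<open>ring_iso\<close> are
    arbitrary outside \<open>K\<close>, and restriction makes the set finite.\<close>
  define G where "G = (\<lambda>\<sigma>. restrict \<sigma> K) ` ring_iso (cx_ring K) (cx_ring K)"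
  have G_E: "G \<subseteq> E"
    by (auto simp: G_def ring_iso_def Ring.ring_hom_def E_iff K_mult K_add K_one)
  have G_K: "\<sigma> y \<in> K" if "\<sigma> \<in> G" "y \<in> K" for \<sigma> y
    using that by (auto simp: G_def ring_iso_def Ring.ring_hom_def)
  have finG: "finite G" using G_E finite_E finite_subset by blast
  have idG: "restrict id K \<in> G"
    unfolding G_def by (rule image_eqI[of _ _ id]) (auto simp: ring_iso_def Ring.ring_hom_def)
  define N where "N = (\<Prod>\<sigma>\<in>G. \<sigma> x)"
  have NK: "N \<in> K" unfolding N_def by (rule K_prod) (rule G_K[OF _ xK])
  \<comment> \<open>Composition with \<tau> permutes \<open>G\<close>, so it only reorders the
    factors of \<open>N\<close>.\<close>
  have fixed: "\<tau> N = N" if \<tau>: "\<tau> \<in> ring_iso (cx_ring K) (cx_ring K)" for \<tau>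
  proof -
    have \<tau>E: "restrict \<tau> K \<in> E" using \<tau> G_E by (auto simp: G_def)
    define f where "f = (\<lambda>\<sigma>. restrict (\<lambda>y. \<tau> (\<sigma> y)) K)"
    have \<tau>inj: "inj_on \<tau> K" using \<tau> by (auto simp: ring_iso_def bij_betw_def)
    have fG: "f ` G \<subseteq> G"
    proof safe
      fix \<sigma> assume "\<sigma> \<in> G"
      then obtain s where s: "s \<in> ring_iso (cx_ring K) (cx_ring K)" "\<sigma> = restrict s K"
        by (auto simp: G_def)
      have "(\<lambda>y. \<tau> (s y)) \<in> ring_iso (cx_ring K) (cx_ring K)"
        using s(1) \<tau> bij_betw_trans[of s K K \<tau> K] unfolding ring_iso_def Ring.ring_hom_def
        by (auto simp: Pi_iff comp_def)
      moreover have "f \<sigma> = restrict (\<lambda>y. \<tau> (s y)) K" by (auto simp: f_def s(2))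
      ultimately show "f \<sigma> \<in> G" by (auto simp: G_def)
    qed
    have "inj_on f G"
    proof (rule inj_onI)
      fix \<sigma> \<rho> assume *: "\<sigma> \<in> G" "\<rho> \<in> G" "f \<sigma> = f \<rho>"
      have "\<sigma> y = \<rho> y" if "y \<in> K" for y
      proof -
        have "\<tau> (\<sigma> y) = \<tau> (\<rho> y)" using *(3) that unfolding f_def by (metis restrict_apply')
        then show ?thesis using \<tau>inj G_K * that by (meson inj_onD)
      qed
      then show "\<sigma> = \<rho>" using * G_E by (meson E_iff extensionalityI subsetD)
    qed
    then have bij: "bij_betw f G G" using fG finG by (simp add: bij_betw_def endo_inj_surj)
    have "\<tau> N = restrict \<tau> K N" using NK by simp
    also have "\<dots> = (\<Prod>\<sigma>\<in>G. restrict \<tau> K (\<sigma> x))"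
      unfolding N_def by (rule emb_prod[OF \<tau>E]) (rule G_K[OF _ xK])
    also have "\<dots> = (\<Prod>\<sigma>\<in>G. (f \<sigma>) x)"
      by (rule prod.cong) (use G_K xK in \<open>auto simp: f_def\<close>)
    also have "\<dots> = N" unfolding N_def by (rule prod.reindex_bij_betw[OF bij])
    finally show ?thesis .
  qed
  then have "N \<in> \<rat>" using NK galois unfolding galois_def by blast
  moreover have "algebraic_int N"
  proof -
    have "algebraic_int (\<Prod>\<sigma>\<in>H. \<sigma> x)" if "finite H" "H \<subseteq> E" for H
      using that by induction (auto intro: algebraic_int_mult_cx emb_algebraic_int[OF _ assms(1)])
    then show ?thesis unfolding N_def using finG G_E by blast
  qed
  ultimately have "N \<in> \<int>" by (rule rational_algebraic_int_is_int[rotated])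
  moreover have "N \<noteq> 0" unfolding N_def using finG G_E emb_eq_0 xK assms(2) by auto
  ultimately have "cmod N \<ge> 1" by (auto elim!: Ints_cases)
  moreover have "cmod N < 1"
  proof -
    have "cmod N = (\<Prod>\<sigma>\<in>G. cmod (\<sigma> x))" by (simp add: N_def prod_norm)
    \<comment> \<open>The factor of the identity is split off to keep the inequality strict.\<close>
    also have "\<dots> = cmod (restrict id K x) * (\<Prod>\<sigma>\<in>G - {restrict id K}. cmod (\<sigma> x))"
      by (rule prod.remove[OF finG idG])
    also have "\<dots> \<le> cmod (restrict id K x) * 1"
      by (intro mult_left_mono prod_le_1) (use small G_E in \<open>auto intro: less_imp_le\<close>)
    also have "\<dots> < 1" using small[OF subsetD[OF G_E idG]] by (simp only: mult_1_right)
    finally show ?thesis .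
  qed
  ultimately show False by simp
qed

end

section \<open>Integers with bounded conjugates\<close>

context galois_field
begin

text \<open>Two integers whose values \<open>2 * (Re (\<sigma> x) + Im (\<sigma> x))\<close> have equal integer parts for all
  \<open>\<sigma>\<close> coincide: replacing \<open>\<sigma>\<close> by its complex conjugate turns the sum into \<open>Re - Im\<close>, so all
  conjugates of the difference are less than 1.\<close>

lemma box_inj:
  assumes "x \<in> OK" "y \<in> OK"
    and eq: "\<And>\<sigma>. \<sigma> \<in> E \<Longrightarrow> \<lfloor>2 * (Re (\<sigma> x) + Im (\<sigma> x))\<rfloor> = \<lfloor>2 * (Re (\<sigma> y) + Im (\<sigma> y))\<rfloor>"
  shows "x = y"
proof (rule ccontr)
  assume "x \<noteq> y"
  have K: "x \<in> K" "y \<in> K" using assms OK_K by auto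
  have d: "x - y \<in> OK" "x - y \<noteq> 0" "x - y \<in> K" using assms \<open>x \<noteq> y\<close> K by (auto intro: OK_diff K_diff)
  obtain \<sigma> where \<sigma>: "\<sigma> \<in> E" "cmod (\<sigma> (x - y)) \<ge> 1" using some_conjugate_ge_1[OF d(1,2)] by blast
  have half: "\<bar>Re (\<tau> (x - y)) + Im (\<tau> (x - y))\<bar> < 1/2" if "\<tau> \<in> E" for \<tau>
  proof -
    have "\<bar>2 * (Re (\<tau> x) + Im (\<tau> x)) - 2 * (Re (\<tau> y) + Im (\<tau> y))\<bar> < 1"
      using eq[OF that] by linarith
    then show ?thesis by (simp add: emb_diff[OF that] K) (simp add: abs_if algebra_simps split: if_splits)
  qed
  have "\<bar>Re (\<sigma> (x - y)) + Im (\<sigma> (x - y))\<bar> < 1/2" by (rule half[OF \<sigma>(1)])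
  moreover have "\<bar>Re (\<sigma> (x - y)) - Im (\<sigma> (x - y))\<bar> < 1/2"
    using half[OF cnj_in_E[OF \<sigma>(1)]] d(3) by simp
  ultimately have "\<bar>Re (\<sigma> (x - y))\<bar> + \<bar>Im (\<sigma> (x - y))\<bar> < 1" by linarith
  then show False using \<sigma>(2) cmod_le[of "\<sigma> (x - y)"] by linarith
qed

text \<open>By \<open>box_inj\<close> an element is determined by one integer for each \<sigma>.
  Since \<open>2 * (Re (\<sigma> x) + Im (\<sigma> x))\<close> is at most
  \<open>4 * r \<sigma>\<close> in absolute value, there are at most
  \<open>8 * r \<sigma> + 2\<close> choices for it, whence the factor 10.\<close>

lemma box_card:
  fixes r :: "(complex \<Rightarrow> complex) \<Rightarrow> real"
  defines "X \<equiv> {x \<in> OK. \<forall>\<sigma>\<in>E. cmod (\<sigma> x) \<le> r \<sigma>}"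
  shows "finite X" "real (card X) \<le> (\<Prod>\<sigma>\<in>E. 10 * max 1 (r \<sigma>))"
proof -
  define f where "f = (\<lambda>x. \<lambda>\<sigma>\<in>E. \<lfloor>2 * (Re (\<sigma> x) + Im (\<sigma> x))\<rfloor>)"
  define P where "P = (\<Pi>\<^sub>E \<sigma>\<in>E. {\<lfloor>- (4 * r \<sigma>)\<rfloor>..\<lfloor>4 * r \<sigma>\<rfloor>})"
  have inj: "inj_on f X"
  proof (rule inj_onI)
    fix x y assume "x \<in> X" "y \<in> X" and eq: "f x = f y"
    then show "x = y"
      using box_inj[of x y] fun_cong[OF eq] unfolding X_def f_def
      by (metis (mono_tags, lifting) mem_Collect_eq restrict_apply')
  qed
  have sub: "f ` X \<subseteq> P"
  proof safe
    fix x assume x: "x \<in> X"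
    have "\<lfloor>- (4 * r \<sigma>)\<rfloor> \<le> \<lfloor>2 * (Re (\<sigma> x) + Im (\<sigma> x))\<rfloor> \<and> \<lfloor>2 * (Re (\<sigma> x) + Im (\<sigma> x))\<rfloor> \<le> \<lfloor>4 * r \<sigma>\<rfloor>"
      if "\<sigma> \<in> E" for \<sigma>
    proof -
      have "cmod (\<sigma> x) \<le> r \<sigma>" using x that by (simp add: X_def)
      then have "\<bar>Re (\<sigma> x)\<bar> \<le> r \<sigma>" "\<bar>Im (\<sigma> x)\<bar> \<le> r \<sigma>"
        using abs_Re_le_cmod[of "\<sigma> x"] abs_Im_le_cmod[of "\<sigma> x"] by linarith+
      then show ?thesis by (auto intro!: floor_mono)
    qed
    then show "f x \<in> P" by (auto simp: P_def f_def)
  qed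
  have finP: "finite P" unfolding P_def by (intro finite_PiE finite_E) auto
  show "finite X" using inj sub finP by (meson finite_imageD finite_subset)
  have "card X \<le> card P" using card_inj_on_le[OF inj sub finP] .
  also have "card P = (\<Prod>\<sigma>\<in>E. card {\<lfloor>- (4 * r \<sigma>)\<rfloor>..\<lfloor>4 * r \<sigma>\<rfloor>})"
    unfolding P_def by (rule card_PiE[OF finite_E])
  finally have "real (card X) \<le> (\<Prod>\<sigma>\<in>E. real (card {\<lfloor>- (4 * r \<sigma>)\<rfloor>..\<lfloor>4 * r \<sigma>\<rfloor>}))"
    by (metis of_nat_le_iff of_nat_prod)
  also have "\<dots> \<le> (\<Prod>\<sigma>\<in>E. 10 * max 1 (r \<sigma>))"
  proof (rule prod_mono, safe)
    fix \<sigma>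
    have "real_of_int (\<lfloor>4 * r \<sigma>\<rfloor> - \<lfloor>- (4 * r \<sigma>)\<rfloor> + 1) \<le> 10 * max 1 (r \<sigma>)" by linarith
    then show "real (card {\<lfloor>- (4 * r \<sigma>)\<rfloor>..\<lfloor>4 * r \<sigma>\<rfloor>}) \<le> 10 * max 1 (r \<sigma>)"
      by (auto simp: of_nat_nat max_def)
  qed simp
  finally show "real (card X) \<le> (\<Prod>\<sigma>\<in>E. 10 * max 1 (r \<sigma>))" .
qed

text \<open>For an integer \<open>x\<close> of \<open>K\<close> this is the Mahler measure of its
  minimal polynomial, raised to the power of the degree of \<open>K\<close> over the field generated
  by \<open>x\<close>.\<close>

definition mahler :: "complex \<Rightarrow> real" where
  "mahler x = (\<Prod>\<sigma>\<in>E. max 1 (cmod (\<sigma> x)))"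

lemma mahler_ge_1: "mahler x \<ge> 1"
  unfolding mahler_def by (rule prod_ge_1) simp

lemma mahler_power: "x \<in> K \<Longrightarrow> mahler (x ^ n) = mahler x ^ n"
proof -
  assume x: "x \<in> K"
  have *: "max 1 (t ^ n) = max 1 t ^ n" if "t \<ge> 0" for t :: real
    using that by (cases "t \<le> 1") (auto simp: max_def power_le_one one_le_power intro: antisym)
  have "max 1 (cmod (\<sigma> (x ^ n))) = max 1 (cmod (\<sigma> x)) ^ n" if "\<sigma> \<in> E" for \<sigma>
    by (simp add: emb_power[OF that] x norm_power *)
  then show ?thesis by (simp add: mahler_def prod_power_distrib)
qed

lemma mahler_power_diff_1:
  assumes "x \<in> K"
  shows "mahler (x ^ n - 1) \<le> 2 ^ card E * mahler x ^ n"
proof -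
  have "mahler (x ^ n - 1) \<le> (\<Prod>\<sigma>\<in>E. 2 * max 1 (cmod (\<sigma> (x ^ n))))"
    unfolding mahler_def
  proof (rule prod_mono, safe)
    fix \<sigma> assume \<sigma>: "\<sigma> \<in> E"
    have "cmod (\<sigma> (x ^ n - 1)) \<le> cmod (\<sigma> (x ^ n)) + 1"
      using norm_triangle_ineq4[of "\<sigma> (x ^ n)" 1]
      by (simp add: emb_diff[OF \<sigma>] emb_1[OF \<sigma>] K_power[OF assms] K_one)
    then show "max 1 (cmod (\<sigma> (x ^ n - 1))) \<le> 2 * max 1 (cmod (\<sigma> (x ^ n)))" by linarith
  qed simp
  also have "\<dots> = 2 ^ card E * mahler x ^ n"
    unfolding mahler_power[OF assms, symmetric] by (simp add: prod.distrib mahler_def)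
  finally show ?thesis .
qed

text \<open>Kronecker's argument: all factors of the product are at least 1, so a product equal to 1
  puts every conjugate of every power of \<open>a\<close> into the unit disc. That box is finite, so
  two powers coincide.\<close>

lemma kronecker_mahler_gt_1:
  assumes "a \<in> OK" "a \<noteq> 0" "\<not> (\<exists>n > 0. a ^ n = 1)"
  shows "mahler a > 1"
proof (rule ccontr)
  assume "\<not> mahler a > 1"
  have aK: "a \<in> K" using assms OK_K by blast
  have le1: "cmod (\<sigma> a) \<le> 1" if "\<sigma> \<in> E" for \<sigma>
  proof (rule ccontr)
    assume "\<not> cmod (\<sigma> a) \<le> 1"
    then have "1 < max 1 (cmod (\<sigma> a)) * 1" by simp
    also have "\<dots> \<le> max 1 (cmod (\<sigma> a)) * (\<Prod>\<tau>\<in>E - {\<sigma>}. max 1 (cmod (\<tau> a)))"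
      by (intro mult_left_mono prod_ge_1) auto
    also have "\<dots> = mahler a" unfolding mahler_def by (rule prod.remove[OF finite_E that, symmetric])
    finally show False using \<open>\<not> mahler a > 1\<close> by simp
  qed
  have "range (\<lambda>n. a ^ n) \<subseteq> {x \<in> OK. \<forall>\<sigma>\<in>E. cmod (\<sigma> x) \<le> 1}"
    using assms(1) aK by (auto simp: OK_power emb_power norm_power le1 power_le_one)
  then have "finite (range (\<lambda>n. a ^ n))" using box_card(1)[of "\<lambda>_. 1"] finite_subset by blast
  then have "\<not> inj (\<lambda>n. a ^ n)" using range_inj_infinite by blast
  then obtain m n where mn: "m < n" "a ^ m = a ^ n" unfolding inj_def by (metis nat_neq_iff)
  then have "a ^ m * a ^ (n - m) = a ^ m * 1" by (metis less_imp_le mult_1_right le_add_diff_inverse power_add)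
  then have "a ^ (n - m) = 1" using assms(2) by (metis mult_cancel_left power_not_zero)
  then show False using assms(3) mn(1) zero_less_diff by blast
qed

section \<open>Division with bounded remainder, and indices of principal ideals\<close>

lemma complex_of_rat: "complex_of_real (of_rat r) = of_rat r"
  by (cases r) (simp add: of_rat_rat)

lemma int_span_subset_OK: "B \<subseteq> OK \<Longrightarrow> cx_int.span B \<subseteq> OK"
  by (rule cx_int.span_minimal) (auto simp: cx_int.subspace_def OK_closed)

text \<open>Round the coordinates of \<open>y / x\<close> down. The remainder is \<open>x\<close>
  times an element with coordinates between 0 and 1, whose conjugates are bounded in terms of
  \<open>B\<close> alone. That the quotient lies in the span of a fixed finite set is what later
  makes ideals finitely generated.\<close>

lemma reduction:
  obtains C B where "C \<ge> 1" "finite B" "B \<subseteq> OK"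
    "\<And>x y. x \<in> OK \<Longrightarrow> x \<noteq> 0 \<Longrightarrow> y \<in> OK \<Longrightarrow>
       \<exists>c\<in>cx_int.span B. \<exists>z\<in>OK. y = x * c + z \<and> (\<forall>\<sigma>\<in>E. cmod (\<sigma> z) \<le> C * cmod (\<sigma> x))"
proof -
  obtain B where B: "finite B" "B \<subseteq> OK" "\<And>z. z \<in> K \<Longrightarrow> \<exists>q. z = (\<Sum>b\<in>B. of_rat (q b) * b)"
    using rat_spanned_by_ints by metis
  then have BK: "b \<in> K" if "b \<in> B" for b using OK_K that by blast
  define C where "C = 1 + (\<Sum>\<sigma>\<in>E. \<Sum>b\<in>B. cmod (\<sigma> b))"
  show ?thesis
  proof
    show "C \<ge> 1" by (simp add: C_def sum_nonneg)
    show "finite B" "B \<subseteq> OK" by fact+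
  next
    fix x y assume xy: "x \<in> OK" "x \<noteq> 0" "y \<in> OK"
    then have xK: "x \<in> K" "y \<in> K" using OK_K by auto
    obtain q where q: "y / x = (\<Sum>b\<in>B. of_rat (q b) * b)" using B(3)[OF K_divide[OF xK(2,1)]] by blast
    define c where "c = (\<Sum>b\<in>B. of_int \<lfloor>q b\<rfloor> * b)"
    define f where "f = (\<Sum>b\<in>B. of_rat (frac (q b)) * b)"
    define z where "z = y - x * c"
    have c: "c \<in> cx_int.span B" unfolding c_def
      by (intro cx_int.span_sum cx_int.span_scale cx_int.span_base)
    then have "c \<in> OK" using int_span_subset_OK[OF B(2)] by blast
    then have z: "z \<in> OK" unfolding z_def using xy by (intro OK_closed)
    have "y / x = c + f"
      unfolding q c_def f_def sum.distrib[symmetric]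
      by (intro sum.cong) (simp_all add: frac_def of_rat_diff algebra_simps)
    then have zf: "z = x * f" using xy(2) by (simp add: z_def field_simps)
    have fK: "f \<in> K" unfolding f_def by (intro K_sum K_mult K_of_rat BK)
    have "cmod (\<sigma> z) \<le> C * cmod (\<sigma> x)" if \<sigma>: "\<sigma> \<in> E" for \<sigma>
    proof -
      have "\<sigma> f = (\<Sum>b\<in>B. of_rat (frac (q b)) * \<sigma> b)"
        unfolding f_def by (simp add: \<sigma> emb_sum emb_mult emb_of_rat K_mult K_of_rat BK)
      also have "cmod \<dots> \<le> (\<Sum>b\<in>B. cmod (of_rat (frac (q b)) * \<sigma> b))" by (rule norm_sum)
      also have "\<dots> \<le> (\<Sum>b\<in>B. cmod (\<sigma> b))"
      proof (rule sum_mono)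
        fix b
        have "0 \<le> (of_rat (frac (q b)) :: real)" "(of_rat (frac (q b)) :: real) \<le> 1"
          using frac_ge_0[of "q b"] frac_lt_1[of "q b"] by (auto simp: zero_le_of_rat_iff intro: less_imp_le)
        moreover have "cmod (of_rat (frac (q b))) = \<bar>of_rat (frac (q b)) :: real\<bar>"
          by (metis norm_of_real complex_of_rat)
        ultimately show "cmod (of_rat (frac (q b)) * \<sigma> b) \<le> cmod (\<sigma> b)"
          by (simp add: norm_mult mult_left_le_one_le)
      qed
      also have "\<dots> \<le> (\<Sum>\<tau>\<in>E. \<Sum>b\<in>B. cmod (\<tau> b))"
        by (rule member_le_sum[OF \<sigma> _ finite_E]) (simp add: sum_nonneg)
      also have "\<dots> \<le> C" by (simp add: C_def)
      finally show ?thesis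
        by (simp add: zf emb_mult[OF \<sigma>] xK fK norm_mult mult.commute[of C] mult_left_mono)
    qed
    then show "\<exists>c\<in>cx_int.span B. \<exists>z\<in>OK. y = x * c + z \<and> (\<forall>\<sigma>\<in>E. cmod (\<sigma> z) \<le> C * cmod (\<sigma> x))"
      using c z by (intro bexI[of _ c] bexI[of _ z]) (auto simp: z_def)
  qed
qed

text \<open>A set with at most one element in each class modulo \<open>I\<close>. Indices are
  handled only through cardinalities of such sets: upper bounds come from boxes, lower bounds from
  Chinese remaindering.\<close>

definition incongruent :: "complex set \<Rightarrow> complex set \<Rightarrow> bool" where
  "incongruent I Y \<longleftrightarrow> Y \<subseteq> OK \<and> (\<forall>y\<in>Y. \<forall>y'\<in>Y. y - y' \<in> I \<longrightarrow> y = y')"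

text \<open>The exact index is the absolute value of the product of the conjugates of \<open>x\<close>; a bound up to
  a constant suffices and avoids determinants.\<close>

lemma principal_index_bound:
  obtains C where "C \<ge> 1"
    "\<And>x Y. x \<in> OK \<Longrightarrow> x \<noteq> 0 \<Longrightarrow> incongruent ((*) x ` OK) Y \<Longrightarrow>
       finite Y \<and> real (card Y) \<le> C * mahler x"
proof -
  obtain C B where "C \<ge> 1" and "B \<subseteq> OK" and
    red: "\<And>x y. x \<in> OK \<Longrightarrow> x \<noteq> 0 \<Longrightarrow> y \<in> OK \<Longrightarrow>
       \<exists>c\<in>cx_int.span B. \<exists>z\<in>OK. y = x * c + z \<and> (\<forall>\<sigma>\<in>E. cmod (\<sigma> z) \<le> C * cmod (\<sigma> x))"
    using reduction by metis
  have C: "C \<ge> 1"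
    "\<And>x y. x \<in> OK \<Longrightarrow> x \<noteq> 0 \<Longrightarrow> y \<in> OK \<Longrightarrow>
       \<exists>c\<in>OK. \<exists>z\<in>OK. y = x * c + z \<and> (\<forall>\<sigma>\<in>E. cmod (\<sigma> z) \<le> C * cmod (\<sigma> x))"
    using \<open>C \<ge> 1\<close> red int_span_subset_OK[OF \<open>B \<subseteq> OK\<close>] by blast+
  show ?thesis
  proof
    show "(10 * C) ^ card E \<ge> 1" using C(1) by (intro one_le_power) linarith
  next
    fix x Y assume x: "x \<in> OK" "x \<noteq> 0" and Y: "incongruent ((*) x ` OK) Y"
    define X where "X = {z \<in> OK. \<forall>\<sigma>\<in>E. cmod (\<sigma> z) \<le> C * cmod (\<sigma> x)}"
    have "\<forall>y\<in>Y. \<exists>z\<in>X. \<exists>c\<in>OK. y = x * c + z"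
      using C(2)[OF x] Y unfolding incongruent_def X_def by blast
    \<comment> \<open>\<open>g\<close> picks a remainder modulo \<open>x\<close>. Remainders lie in
      a box, and elements of \<open>Y\<close> with equal remainders differ by a multiple of
      \<open>x\<close>.\<close>
    then obtain g where g: "\<And>y. y \<in> Y \<Longrightarrow> g y \<in> X \<and> (\<exists>c\<in>OK. y = x * c + g y)" by metis
    have inj: "inj_on g Y"
    proof (rule inj_onI)
      fix y y' assume y: "y \<in> Y" "y' \<in> Y" "g y = g y'"
      obtain c c' where c: "c \<in> OK" "c' \<in> OK" "y = x * c + g y" "y' = x * c' + g y'" using g y by metis
      then have "y - y' = x * (c - c')" using y(3) by (metis add_diff_cancel_right right_diff_distrib)
      then have "y - y' \<in> (*) x ` OK" using c OK_diff by blast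
      then show "y = y'" using Y y unfolding incongruent_def by blast
    qed
    have sub: "g ` Y \<subseteq> X" using g by blast
    have finX: "finite X" unfolding X_def by (rule box_card)
    have "real (card Y) \<le> real (card X)" using card_inj_on_le[OF inj sub finX] by simp
    also have "\<dots> \<le> (\<Prod>\<sigma>\<in>E. 10 * max 1 (C * cmod (\<sigma> x)))" unfolding X_def by (rule box_card)
    also have "\<dots> \<le> (\<Prod>\<sigma>\<in>E. (10 * C) * max 1 (cmod (\<sigma> x)))"
    proof (rule prod_mono, safe)
      fix \<sigma>
      have "max 1 (C * cmod (\<sigma> x)) \<le> C * max 1 (cmod (\<sigma> x))"
        using C(1) by (auto simp: max_def intro: mult_left_mono order_trans[OF C(1)])
      then show "10 * max 1 (C * cmod (\<sigma> x)) \<le> (10 * C) * max 1 (cmod (\<sigma> x))" by simp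
    qed simp
    also have "\<dots> = (10 * C) ^ card E * mahler x" by (simp add: prod.distrib mahler_def power_mult_distrib)
    finally show "finite Y \<and> real (card Y) \<le> (10 * C) ^ card E * mahler x"
      using finite_imageD[OF finite_subset[OF sub finX] inj] by simp
  qed
qed

end

section \<open>Ideals and places\<close>

context galois_field
begin

lemma cring_OK: "cring (int_ring K)"
proof (rule cringI)
  show "abelian_group (int_ring K)"
  proof (rule abelian_groupI)
    fix x assume "x \<in> carrier (int_ring K)"
    then show "\<exists>y\<in>carrier (int_ring K). y \<oplus>\<^bsub>int_ring K\<^esub> x = \<zero>\<^bsub>int_ring K\<^esub>"
      by (intro bexI[of _ "-x"]) (auto simp: OK_uminus)
  qed (auto simp: OK_closed)
  show "comm_monoid (int_ring K)"
    by (rule comm_monoidI) (auto simp: OK_closed)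
qed (auto simp: algebra_simps)

sublocale R: cring "int_ring K"
  by (rule cring_OK)

lemma a_inv_OK: "x \<in> OK \<Longrightarrow> \<ominus>\<^bsub>int_ring K\<^esub> x = - x"
  using R.minus_equality[of "-x" x] OK_uminus by simp

abbreviation is_ideal :: "complex set \<Rightarrow> bool" where
  "is_ideal I \<equiv> ideal I (int_ring K)"

lemma is_idealI:
  assumes "I \<subseteq> OK" "0 \<in> I" "\<And>x y. x \<in> I \<Longrightarrow> y \<in> I \<Longrightarrow> x + y \<in> I"
    "\<And>x r. x \<in> I \<Longrightarrow> r \<in> OK \<Longrightarrow> r * x \<in> I"
  shows "is_ideal I"
proof (rule idealI[OF R.ring_axioms])
  have neg: "- x \<in> I" if "x \<in> I" for x using assms(4)[OF that OK_uminus[OF OK_1]] by simp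
  show "subgroup I (add_monoid (int_ring K))"
  proof (rule R.add.subgroupI)
    fix x assume x: "x \<in> I"
    then show "\<ominus>\<^bsub>int_ring K\<^esub> x \<in> I"
      using a_inv_OK[of x] neg assms(1) by auto
  qed (use assms in auto)
qed (use assms in \<open>auto simp: mult.commute\<close>)

lemma
  assumes "is_ideal I"
  shows ideal_OK: "x \<in> I \<Longrightarrow> x \<in> OK"
    and ideal_0: "0 \<in> I"
    and ideal_add: "x \<in> I \<Longrightarrow> y \<in> I \<Longrightarrow> x + y \<in> I"
    and ideal_mult: "r \<in> OK \<Longrightarrow> x \<in> I \<Longrightarrow> r * x \<in> I"
    and ideal_mult': "r \<in> OK \<Longrightarrow> x \<in> I \<Longrightarrow> x * r \<in> I"
    and ideal_diff: "x \<in> I \<Longrightarrow> y \<in> I \<Longrightarrow> x - y \<in> I"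
proof -
  interpret ideal I "int_ring K" by fact
  show OK: "x \<in> I \<Longrightarrow> x \<in> OK" for x using Icarr by simp
  show "0 \<in> I" using zero_closed by simp
  show add: "x \<in> I \<Longrightarrow> y \<in> I \<Longrightarrow> x + y \<in> I" for x y using a_closed by simp
  show mult: "r \<in> OK \<Longrightarrow> x \<in> I \<Longrightarrow> r * x \<in> I" for r x using I_l_closed[of x r] by simp
  show "r \<in> OK \<Longrightarrow> x \<in> I \<Longrightarrow> x * r \<in> I" using mult by (simp add: mult.commute)
  show "x \<in> I \<Longrightarrow> y \<in> I \<Longrightarrow> x - y \<in> I" using add[of x "-1 * y"] mult[of "-1" y] OK_uminus[OF OK_1] by simp
qed

lemma PIdl_eq: "PIdl\<^bsub>int_ring K\<^esub> x = (*) x ` OK"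
  by (auto simp: cgenideal_def mult.commute)

lemma principal_ideal: "x \<in> OK \<Longrightarrow> is_ideal ((*) x ` OK)"
  using R.cgenideal_ideal[of x] by (simp add: PIdl_eq)

abbreviation ip :: "complex set \<Rightarrow> complex set \<Rightarrow> complex set" where
  "ip \<equiv> ideal_prod (int_ring K)"

lemma ipI: "x \<in> I \<Longrightarrow> y \<in> J \<Longrightarrow> x * y \<in> ip I J"
  using ideal_prod.prod[of x I y J "int_ring K"] by simp

lemma ip_add: "x \<in> ip I J \<Longrightarrow> y \<in> ip I J \<Longrightarrow> x + y \<in> ip I J"
  using ideal_prod.sum[of x "int_ring K" I J y] by simp

lemma ip_subset:
  assumes "\<And>x y. x \<in> I \<Longrightarrow> y \<in> J \<Longrightarrow> x * y \<in> S" "\<And>x y. x \<in> S \<Longrightarrow> y \<in> S \<Longrightarrow> x + y \<in> S"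
  shows "ip I J \<subseteq> S"
proof
  fix s assume "s \<in> ip I J"
  then show "s \<in> S" by induction (use assms in auto)
qed

definition ipow :: "complex set \<Rightarrow> nat \<Rightarrow> complex set" where
  "ipow P n = P [^]\<^bsub>ideals_set (int_ring K)\<^esub> n"

lemma ipow_0: "ipow P 0 = OK"
  by (simp add: ipow_def nat_pow_def ideals_set_def)

lemma ipow_Suc: "ipow P (Suc n) = ip (ipow P n) P"
  by (simp add: ipow_def nat_pow_def ideals_set_def)

lemma ipow_ideal: "is_ideal P \<Longrightarrow> is_ideal (ipow P n)"
proof (induction n)
  case 0
  then show ?case using R.oneideal by (simp add: ipow_0)
qed (auto simp: ipow_Suc R.ideal_prod_is_ideal)

lemma ipow_1: "is_ideal P \<Longrightarrow> ipow P 1 = P"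
  using R.ideal_prod_one[of P] R.ideal_prod_commute[OF _ R.oneideal, of P] by (simp add: ipow_Suc ipow_0)

lemma ipow_2: "is_ideal P \<Longrightarrow> ipow P 2 = ip P P"
  using ipow_1[of P] ipow_Suc[of P 1] by (simp add: numeral_2_eq_2)

lemma ipow_le_2:
  assumes "is_ideal P" "n \<ge> 2"
  shows "ipow P n \<subseteq> ip P P"
  using assms(2)
proof (induction rule: dec_induct)
  case base
  then show ?case using ipow_2[OF assms(1)] by simp
next
  case (step n)
  then show ?case using R.ideal_prod_inter[OF ipow_ideal[OF assms(1)] assms(1)] by (auto simp: ipow_Suc)
qed

lemma divides_iff: "I divides\<^bsub>ideals_set (int_ring K)\<^esub> J \<longleftrightarrow> (\<exists>L. is_ideal L \<and> J = ip I L)"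
  by (auto simp: factor_def ideals_set_def)

section \<open>Residue classes and finite index\<close>

lemma incongruent_mono: "incongruent I Y \<Longrightarrow> J \<subseteq> I \<Longrightarrow> incongruent J Y"
  unfolding incongruent_def by blast

lemma principal_subset: "is_ideal I \<Longrightarrow> x \<in> I \<Longrightarrow> (*) x ` OK \<subseteq> I"
  using ideal_mult' by auto

lemma incongruent_finite:
  assumes "is_ideal I" "x \<in> I" "x \<noteq> 0"
  obtains N where "\<And>Y. incongruent I Y \<Longrightarrow> finite Y \<and> card Y \<le> N"
proof -
  obtain C where C: "\<And>x Y. x \<in> OK \<Longrightarrow> x \<noteq> 0 \<Longrightarrow> incongruent ((*) x ` OK) Y \<Longrightarrow>
       finite Y \<and> real (card Y) \<le> C * mahler x"
    using principal_index_bound by metis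
  have "finite Y \<and> card Y \<le> nat \<lceil>C * mahler x\<rceil>" if "incongruent I Y" for Y
    using C[OF ideal_OK[OF assms(1,2)] assms(3) incongruent_mono[OF that principal_subset[OF assms(1,2)]]]
    by linarith
  then show ?thesis using that by blast
qed

text \<open>Cardinalities of incongruent sets are bounded, so one of maximal size inside
  \<open>S\<close> exists; an element of \<open>S\<close> in a new class could be added to
  it.\<close>

lemma representatives:
  assumes "is_ideal I" "x \<in> I" "x \<noteq> 0" "S \<subseteq> OK"
  obtains F where "F \<subseteq> S" "finite F" "incongruent I F" "\<And>s. s \<in> S \<Longrightarrow> \<exists>f\<in>F. s - f \<in> I"
proof -
  obtain N where N: "\<And>Y. incongruent I Y \<Longrightarrow> finite Y \<and> card Y \<le> N"
    using incongruent_finite[OF assms(1-3)] by metis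
  let ?P = "\<lambda>Y. Y \<subseteq> S \<and> incongruent I Y"
  have "?P {}" by (simp add: incongruent_def)
  moreover have "\<forall>Y. ?P Y \<longrightarrow> card Y < Suc N" using N le_imp_less_Suc by blast
  ultimately obtain F where F: "?P F" "\<And>Y. ?P Y \<Longrightarrow> card Y \<le> card F"
    using ex_has_greatest_nat[of ?P "{}" card "Suc N"] by blast
  have finF: "finite F" using F N by blast
  have "\<exists>f\<in>F. s - f \<in> I" if s: "s \<in> S" for s
  proof (rule ccontr)
    assume none: "\<not> ?thesis"
    then have "s \<notin> F" using ideal_0[OF assms(1)] by auto
    have "f - s \<notin> I" if "f \<in> F" for f
      using none that ideal_diff[OF assms(1) ideal_0[OF assms(1)], of "f - s"] by auto
    then have "?P (insert s F)" using F(1) s assms(4) none unfolding incongruent_def by blast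
    then have "card (insert s F) \<le> card F" by (rule F(2))
    then show False using \<open>s \<notin> F\<close> finF by simp
  qed
  then show ?thesis using that F finF by blast
qed

text \<open>Pigeonhole on the powers of \<open>z\<close> modulo \<open>x\<close>. This is the form
  in which finiteness of the residue ring is used to invert elements modulo places.\<close>

lemma power_periodic:
  assumes "x \<in> OK" "x \<noteq> 0" "z \<in> OK"
  obtains i j :: nat where "i < j" "z ^ j - z ^ i \<in> (*) x ` OK"
proof -
  have x: "x \<in> (*) x ` OK" using OK_1 by force
  note I = principal_ideal[OF assms(1)]
  have "\<exists>i j :: nat. i < j \<and> z ^ j - z ^ i \<in> (*) x ` OK"
  proof (rule ccontr)
    assume no: "\<not> ?thesis"
    have *: "i = j" if ij: "z ^ j - z ^ i \<in> (*) x ` OK" for i j :: nat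
    proof (rule ccontr)
      assume "i \<noteq> j"
      then consider "i < j" | "j < i" by linarith
      then show False
      proof cases
        case 2
        have "z ^ i - z ^ j \<in> (*) x ` OK" using ideal_diff[OF I ideal_0[OF I] ij] by simp
        then show False using no 2 by blast
      qed (use no ij in blast)
    qed
    then have "incongruent ((*) x ` OK) (range (\<lambda>i. z ^ i))"
      using assms(3) unfolding incongruent_def by (auto simp: OK_power)
    then have "finite (range (\<lambda>i. z ^ i))" using incongruent_finite[OF I x assms(2)] by metis
    moreover have "inj (\<lambda>i. z ^ i)" using * ideal_0[OF I] by (auto intro!: injI)
    ultimately show False using range_inj_infinite by blast
  qed
  then show ?thesis using that by blast
qed

section \<open>Units modulo powers of a place\<close>

context
  fixes P
  assumes P: "P \<in> finite_places K"
begin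

lemma place_ideal: "is_ideal P"
  using P unfolding finite_places_def primeideal_def by blast

lemma place_prime: "x \<in> OK \<Longrightarrow> y \<in> OK \<Longrightarrow> x * y \<in> P \<Longrightarrow> x \<in> P \<or> y \<in> P"
  using P primeideal.I_prime[of P "int_ring K" x y] unfolding finite_places_def by simp

lemma place_1: "1 \<notin> P"
proof
  assume "1 \<in> P"
  then have "P = OK" using ideal_OK[OF place_ideal] ideal_mult[OF place_ideal] by force
  then show False using P primeideal.I_notcarr[of P "int_ring K"] unfolding finite_places_def by simp
qed

lemma place_nonzero: obtains x where "x \<in> P" "x \<noteq> 0"
  using P ideal_0[OF place_ideal] unfolding finite_places_def by blast

lemma place_power: "x \<in> OK \<Longrightarrow> x ^ n \<in> P \<Longrightarrow> x \<in> P"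
  by (induction n) (use place_1 place_prime OK_power in auto)

text \<open>Periodicity gives \<open>z ^ i * (z ^ (j - i) - 1) \<in> P\<close>. As \<open>P\<close>
  is prime and omits \<open>z\<close>, the second factor lies in \<open>P\<close>, and
  \<open>z ^ (j - i - 1)\<close> inverts \<open>z\<close>.\<close>

lemma place_maximal:
  assumes z: "z \<in> OK" "z \<notin> P"
  obtains r where "r \<in> OK" "1 - r * z \<in> P"
proof -
  obtain x where x: "x \<in> P" "x \<noteq> 0" using place_nonzero by blast
  have xO: "x \<in> OK" using ideal_OK[OF place_ideal x(1)] .
  obtain i j where ij: "i < j" "z ^ j - z ^ i \<in> (*) x ` OK"
    using power_periodic[OF xO x(2) z(1)] by blast
  then have "z ^ j - z ^ i \<in> P" using principal_subset[OF place_ideal x(1)] by blast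
  moreover have "z ^ j - z ^ i = z ^ i * (z ^ (j - i) - 1)"
    using ij(1) by (simp add: algebra_simps flip: power_add)
  ultimately have "z ^ (j - i) - 1 \<in> P"
    using place_prime place_power z by (metis OK_1 OK_diff OK_power)
  then have "0 - (z ^ (j - i) - 1) \<in> P" using ideal_diff[OF place_ideal ideal_0[OF place_ideal]] by blast
  moreover have "z ^ (j - i) = z ^ (j - i - 1) * z" using ij(1) power_minus_mult[of "j - i" z] by simp
  ultimately show ?thesis using that[of "z ^ (j - i - 1)"] OK_power[OF z(1)] by simp
qed

text \<open>Errors multiply: the product of \<open>1 - r * z\<close> and \<open>1 - s * z\<close> is
  again 1 minus a multiple of \<open>z\<close>, and it lies one power of \<open>P\<close>
  deeper.\<close>

lemma place_power_comaximal:
  assumes z: "z \<in> OK" "z \<notin> P"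
  obtains r where "r \<in> OK" "1 - r * z \<in> ipow P n"
proof -
  have "\<exists>r\<in>OK. 1 - r * z \<in> ipow P n"
  proof (induction n)
    case 0
    then show ?case using OK_0 OK_1 by (intro bexI[of _ 0]) (auto simp: ipow_0)
  next
    case (Suc n)
    then obtain r where r: "r \<in> OK" "1 - r * z \<in> ipow P n" by blast
    obtain s where s: "s \<in> OK" "1 - s * z \<in> P" using place_maximal[OF z] .
    have "(1 - r * z) * (1 - s * z) \<in> ipow P (Suc n)" unfolding ipow_Suc by (rule ipI[OF r(2) s(2)])
    moreover have "(1 - r * z) * (1 - s * z) = 1 - (r + s - r * s * z) * z" by (simp add: algebra_simps)
    ultimately show ?case using r s z OK_closed by (metis (no_types, lifting))
  qed
  then show ?thesis using that by blast
qed

text \<open>With \<open>r\<close> inverting \<open>z\<close> modulo the power of \<open>P\<close>,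
  write \<open>y\<close> as \<open>y * (1 - r * z) + r * (z * y)\<close>.\<close>

lemma place_power_primary:
  assumes "z \<in> OK" "z \<notin> P" "y \<in> OK" "z * y \<in> ipow P n"
  shows "y \<in> ipow P n"
proof -
  note I = ipow_ideal[OF place_ideal, of n]
  obtain r where r: "r \<in> OK" "1 - r * z \<in> ipow P n" using place_power_comaximal[OF assms(1,2)] .
  have "y * (1 - r * z) + r * (z * y) \<in> ipow P n"
    using ideal_add[OF I ideal_mult[OF I assms(3) r(2)] ideal_mult[OF I r(1) assms(4)]] .
  then show ?thesis by (simp add: algebra_simps)
qed

text \<open>Valuations are defined through divisibility of ideals, not containment, so a cofactor
  has to be carried over in each direction: from \<open>z * y\<close> to \<open>y\<close> by the
  colon ideal of \<open>J\<close> by \<open>z\<close>, from \<open>y\<close> to \<open>z * y\<close>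
  by multiplying \<open>J\<close> by \<open>z\<close>.\<close>

lemma int_val_mult_unit:
  assumes z: "z \<in> OK" "z \<notin> P" and y: "y \<in> OK"
  shows "int_val K P (z * y) = int_val K P y"
proof -
  have z0: "z \<noteq> 0" using z ideal_0[OF place_ideal] by blast
  have "(ipow P n divides\<^bsub>ideals_set (int_ring K)\<^esub> PIdl\<^bsub>int_ring K\<^esub> (z * y)) =
        (ipow P n divides\<^bsub>ideals_set (int_ring K)\<^esub> PIdl\<^bsub>int_ring K\<^esub> y)" for n
  proof -
    note I = ipow_ideal[OF place_ideal, of n]
    show ?thesis unfolding divides_iff PIdl_eq
    proof safe
      fix J assume J: "is_ideal J" and eq: "(*) (z * y) ` OK = ip (ipow P n) J"
      obtain r where r: "r \<in> OK" "1 - r * z \<in> ipow P n" using place_power_comaximal[OF z] .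
      define J' where "J' = {j \<in> OK. z * j \<in> J}"
      have J': "is_ideal J'"
        by (rule is_idealI)
          (use J in \<open>auto simp: J'_def OK_closed ideal_0 ideal_add ideal_mult distrib_left mult.left_commute[of z] z\<close>)
      \<comment> \<open>All of \<open>J\<close> is divisible by \<open>z\<close>:
        \<open>(1 - r * z) * j\<close> lies in the product ideal, hence is a multiple of
        \<open>z * y\<close>, and \<open>r * z * j\<close> is a multiple of \<open>z\<close>
        anyway.\<close>
      have Jz: "\<exists>j'\<in>J'. j = z * j'" if j: "j \<in> J" for j
      proof -
        have "(1 - r * z) * j \<in> ip (ipow P n) J" by (rule ipI[OF r(2) j])
        then obtain o1 where o1: "o1 \<in> OK" "(1 - r * z) * j = (z * y) * o1" unfolding eq[symmetric] by auto
        then have e: "j = z * (r * j + y * o1)" by (simp add: algebra_simps)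
        moreover have "r * j + y * o1 \<in> OK" using r o1 y ideal_OK[OF J j] by (intro OK_closed)
        ultimately show ?thesis using j by (auto simp: J'_def)
      qed
      have "(*) y ` OK = ip (ipow P n) J'"
      proof
        show "ip (ipow P n) J' \<subseteq> (*) y ` OK"
        proof (rule ip_subset)
          fix p j assume pj: "p \<in> ipow P n" "j \<in> J'"
          then have "p * (z * j) \<in> ip (ipow P n) J" by (intro ipI) (auto simp: J'_def)
          then obtain o1 where o1: "o1 \<in> OK" "p * (z * j) = (z * y) * o1" unfolding eq[symmetric] by auto
          then have "z * (p * j) = z * (y * o1)" by (simp add: mult_ac)
          then show "p * j \<in> (*) y ` OK" using z0 o1(1) by auto
        qed (use ideal_add[OF principal_ideal[OF y]] in auto)
        have "(*) (z * y) ` OK \<subseteq> (*) z ` ip (ipow P n) J'"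
          unfolding eq
        proof (rule ip_subset)
          fix p j assume pj: "p \<in> ipow P n" "j \<in> J"
          then obtain j' where j': "j' \<in> J'" "j = z * j'" using Jz by blast
          then show "p * j \<in> (*) z ` ip (ipow P n) J'"
            using ipI[OF pj(1) j'(1)] by (auto simp: mult.left_commute)
        next
          fix u v assume "u \<in> (*) z ` ip (ipow P n) J'" "v \<in> (*) z ` ip (ipow P n) J'"
          then show "u + v \<in> (*) z ` ip (ipow P n) J'" using ip_add by (auto simp: distrib_left[symmetric])
        qed
        then show "(*) y ` OK \<subseteq> ip (ipow P n) J'" using z0 by (force simp: mult.assoc)
      qed
      then show "\<exists>L. is_ideal L \<and> (*) y ` OK = ip (ipow P n) L" using J' by blast
    next
      fix J assume J: "is_ideal J" and eq: "(*) y ` OK = ip (ipow P n) J"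
      have J': "is_ideal ((*) z ` J)"
      proof (rule is_idealI)
        show "0 \<in> (*) z ` J" using ideal_0[OF J] by force
        show "r * x \<in> (*) z ` J" if "x \<in> (*) z ` J" "r \<in> OK" for r x
          using that ideal_mult[OF J] by (auto simp: mult.left_commute)
      qed (use ideal_add[OF J] ideal_OK[OF J] in \<open>auto simp: OK_mult z distrib_left[symmetric]\<close>)
      have "(*) (z * y) ` OK = ip (ipow P n) ((*) z ` J)"
      proof
        show "ip (ipow P n) ((*) z ` J) \<subseteq> (*) (z * y) ` OK"
        proof (rule ip_subset)
          fix p j assume pj: "p \<in> ipow P n" "j \<in> (*) z ` J"
          then obtain j' where j': "j' \<in> J" "j = z * j'" by blast
          have "p * j' \<in> (*) y ` OK" unfolding eq by (rule ipI[OF pj(1) j'(1)])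
          then show "p * j \<in> (*) (z * y) ` OK" using j' by (auto simp: mult_ac image_iff)
        qed (use ideal_add[OF principal_ideal[OF OK_mult[OF z(1) y]]] in auto)
        have "ip (ipow P n) J \<subseteq> {u. z * u \<in> ip (ipow P n) ((*) z ` J)}"
        proof (rule ip_subset)
          fix p j assume pj: "p \<in> ipow P n" "j \<in> J"
          show "p * j \<in> {u. z * u \<in> ip (ipow P n) ((*) z ` J)}"
            using ipI[OF pj(1) imageI[OF pj(2), of "(*) z"]] by (simp add: mult.left_commute)
        qed (auto simp: distrib_left ip_add)
        then show "(*) (z * y) ` OK \<subseteq> ip (ipow P n) ((*) z ` J)" unfolding eq[symmetric] by (auto simp: mult.assoc)
      qed
      then show "\<exists>L. is_ideal L \<and> (*) (z * y) ` OK = ip (ipow P n) L" using J' by blast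
    qed
  qed
  then show ?thesis unfolding int_val_def ideal_exponent_def ipow_def by presburger
qed

text \<open>Every representation \<open>z = x / y\<close> has \<open>x = z * y\<close>, so both
  valuations in \<open>field_val\<close> are equal and cancel whatever \<open>the_enat\<close>
  returns. The norm must be positive because \<open>0 powr 0 = 0\<close>; \<open>norm_ge_2\<close>
  supplies this later.\<close>

lemma finite_abs_unit:
  assumes z: "z \<in> OK" "z \<notin> P" and norm: "ideal_norm K P > 0"
  shows "finite_abs K P z = 1"
proof -
  have z0: "z \<noteq> 0" using z ideal_0[OF place_ideal] by blast
  have "field_val K P z = 0"
    unfolding field_val_def
  proof (rule the_equality)
    show "\<exists>x\<in>carrier (int_ring K). \<exists>y\<in>carrier (int_ring K). x \<noteq> 0 \<and> y \<noteq> 0 \<and> z = x / y \<and>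
        0 = int (the_enat (int_val K P x)) - int (the_enat (int_val K P y))"
      using z z0 OK_1 int_val_mult_unit[OF z OK_1] by (intro bexI[of _ z] bexI[of _ 1]) auto
  next
    fix m assume "\<exists>x\<in>carrier (int_ring K). \<exists>y\<in>carrier (int_ring K). x \<noteq> 0 \<and> y \<noteq> 0 \<and> z = x / y \<and>
        m = int (the_enat (int_val K P x)) - int (the_enat (int_val K P y))"
    then obtain x y where xy: "x \<in> OK" "y \<in> OK" "y \<noteq> 0" "z = x / y"
      "m = int (the_enat (int_val K P x)) - int (the_enat (int_val K P y))" by auto
    then have "x = z * y" by simp
    then show "m = 0" using int_val_mult_unit[OF z xy(2)] xy(5) by simp
  qed
  then show ?thesis using norm by (simp add: finite_abs_def)
qed

end

end

section \<open>Invertibility of places and non-Wieferich places\<close>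

context galois_field
begin

lemma ideal_sum: "is_ideal I \<Longrightarrow> (\<And>i. i \<in> A \<Longrightarrow> f i \<in> I) \<Longrightarrow> sum f A \<in> I"
  by (induction A rule: infinite_finite_induct) (auto simp: ideal_0 ideal_add)

lemma prod_congruent:
  assumes I: "is_ideal I"
    and "\<And>i. i \<in> A \<Longrightarrow> u i \<in> OK" "\<And>i. i \<in> A \<Longrightarrow> v i \<in> OK" "\<And>i. i \<in> A \<Longrightarrow> u i - v i \<in> I"
  shows "prod u A - prod v A \<in> I"
  using assms(2-)
proof (induction A rule: infinite_finite_induct)
  case (insert i A)
  have "u i * (prod u A - prod v A) + prod v A * (u i - v i) \<in> I"
    by (intro ideal_add[OF I] ideal_mult[OF I] insert.IH OK_prod) (use insert.prems in auto)
  then show ?case using insert.hyps by (simp add: algebra_simps)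
qed (auto simp: ideal_0[OF I])

text \<open>Reduce an element of \<open>I\<close> modulo \<open>x\<close>: the quotient part is
  spanned by the multiples \<open>x * b\<close>, and the remainder stays in \<open>I\<close> with
  bounded conjugates, so it is one of finitely many.\<close>

lemma ideal_finitely_spanned:
  assumes I: "is_ideal I" and x: "x \<in> I" "x \<noteq> 0"
  obtains G where "finite G" "G \<subseteq> I" "I \<subseteq> cx_int.span G"
proof -
  obtain C B where B: "finite B" "B \<subseteq> OK"
    "\<And>x y. x \<in> OK \<Longrightarrow> x \<noteq> 0 \<Longrightarrow> y \<in> OK \<Longrightarrow>
       \<exists>c\<in>cx_int.span B. \<exists>z\<in>OK. y = x * c + z \<and> (\<forall>\<sigma>\<in>E. cmod (\<sigma> z) \<le> C * cmod (\<sigma> x))"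
    using reduction by metis
  have xO: "x \<in> OK" using ideal_OK[OF I x(1)] .
  define G where "G = (*) x ` B \<union> {z \<in> I. \<forall>\<sigma>\<in>E. cmod (\<sigma> z) \<le> C * cmod (\<sigma> x)}"
  have "finite {z \<in> I. \<forall>\<sigma>\<in>E. cmod (\<sigma> z) \<le> C * cmod (\<sigma> x)}"
    by (rule finite_subset[OF _ box_card(1)[of "\<lambda>\<sigma>. C * cmod (\<sigma> x)"]]) (use ideal_OK[OF I] in auto)
  then have fin: "finite G" using B(1) by (simp add: G_def)
  have GI: "G \<subseteq> I" using ideal_mult'[OF I _ x(1)] B(2) by (auto simp: G_def)
  have "I \<subseteq> cx_int.span G"
  proof
    fix y assume y: "y \<in> I"
    obtain c z where cz: "c \<in> cx_int.span B" "y = x * c + z" "\<forall>\<sigma>\<in>E. cmod (\<sigma> z) \<le> C * cmod (\<sigma> x)"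
      using B(3)[OF xO x(2) ideal_OK[OF I y]] by blast
    have "c \<in> OK" using cz(1) int_span_subset_OK[OF B(2)] by blast
    then have "z \<in> I" using ideal_diff[OF I y ideal_mult'[OF I \<open>c \<in> OK\<close> x(1)]] cz(2) by simp
    then have "z \<in> cx_int.span G" using cz(3) by (intro cx_int.span_base) (simp add: G_def)
    moreover have "x * c \<in> cx_int.span G"
      using span_mult_image[OF cz(1), of x] cx_int.span_mono[of "(*) x ` B" G] by (auto simp: G_def)
    ultimately show "y \<in> cx_int.span G" unfolding cz(2) by (rule cx_int.span_add[rotated])
  qed
  then show ?thesis using that fin GI by blast
qed

context
  fixes P
  assumes P: "P \<in> finite_places K"
begin

private lemmas I = place_ideal[OF P]

text \<open>An element \<open>b\<close> outside the localisation of \<open>x OK\<close> at \<open>P\<close> is multiplied by powers of the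
  elements of a finite set of generators as long as it stays outside. This is possible because some
  multiple of a power of each \<open>r \<in> P\<close> by an element prime to \<open>P\<close> lies in \<open>x OK\<close>.\<close>

lemma annihilated_by_place:
  assumes x: "x \<in> P" "x \<noteq> 0"
  obtains b where "b \<in> OK" "b \<notin> (*) x ` OK" "\<And>p. p \<in> P \<Longrightarrow> b * p \<in> (*) x ` OK"
proof -
  let ?A = "(*) x ` OK"
  have xO: "x \<in> OK" using ideal_OK[OF I x(1)] .
  note A = principal_ideal[OF xO]
  have xA: "x \<in> ?A" using OK_1 by force
  obtain F where F: "F \<subseteq> P" "finite F" "\<And>s. s \<in> P \<Longrightarrow> \<exists>f\<in>F. s - f \<in> ?A"
    using representatives[OF A xA x(2), of P] ideal_OK[OF I] by (metis subsetI)
  \<comment> \<open>\<open>far b\<close> says that \<open>b\<close> remains outside the multiples of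
    \<open>x\<close> after localisation at \<open>P\<close>.\<close>
  define far where "far b \<longleftrightarrow> b \<in> OK \<and> (\<forall>s\<in>OK - P. s * b \<notin> ?A)" for b
  have "\<exists>b. far b \<and> (\<forall>r\<in>F. b * r \<in> ?A)"
    using F(2,1)
  proof induction
    case empty
    have "far 1" using OK_1 principal_subset[OF I x(1)] by (auto simp: far_def)
    then show ?case by blast
  next
    case (insert r F)
    then obtain b where b: "far b" "\<And>f. f \<in> F \<Longrightarrow> b * f \<in> ?A" by auto
    have rP: "r \<in> P" and rO: "r \<in> OK" and bO: "b \<in> OK"
      using insert.prems ideal_OK[OF I] b(1) by (auto simp: far_def)
    define bad where "bad e \<longleftrightarrow> (\<exists>s\<in>OK - P. s * (r ^ e * b) \<in> ?A)" for e :: nat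
    have "\<exists>e. bad e"
    proof -
      obtain i j :: nat where ij: "i < j" "r ^ j - r ^ i \<in> ?A" using power_periodic[OF xO x(2) rO] .
      have "r ^ (j - i) \<in> P" using ideal_mult[OF I OK_power[OF rO, of "j - i - 1"] rP]
        power_minus_mult[of "j - i" r] ij(1) by simp
      then have "r ^ (j - i) - 1 \<notin> P"
        using ideal_diff[OF I, of "r ^ (j - i)" "r ^ (j - i) - 1"] place_1[OF P] by auto
      moreover have "r ^ (j - i) - 1 \<in> OK" using rO by (intro OK_closed)
      moreover have "(r ^ (j - i) - 1) * (r ^ i * b) = b * (r ^ j - r ^ i)"
        using ij(1) by (simp add: algebra_simps flip: power_add)
      ultimately have "bad i" using ideal_mult[OF A bO ij(2)] unfolding bad_def by (metis DiffI)
      then show ?thesis by blast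
    qed
    \<comment> \<open>The least exponent for which \<open>r ^ e * b\<close> enters the localisation;
      it is positive, one power of \<open>r\<close> less is still far, and \<open>s\<close> clears
      the denominator.\<close>
    then obtain e where e: "bad e" "\<And>e'. e' < e \<Longrightarrow> \<not> bad e'" using exists_least_iff[of bad] by blast
    have "\<not> bad 0" using b(1) by (auto simp: bad_def far_def)
    then obtain e' where e': "e = Suc e'" using e by (cases e) auto
    obtain s where s: "s \<in> OK" "s \<notin> P" "s * (r ^ e * b) \<in> ?A" using e(1) by (auto simp: bad_def)
    define b' where "b' = s * r ^ e' * b"
    have b'O: "b' \<in> OK" unfolding b'_def using s rO bO by (intro OK_closed)
    have "s' * b' \<notin> ?A" if s': "s' \<in> OK" "s' \<notin> P" for s'
    proof
      assume *: "s' * b' \<in> ?A"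
      have "s' * s \<in> OK - P" using s s' OK_mult place_prime[OF P] by blast
      moreover have "s' * b' = (s' * s) * (r ^ e' * b)" by (simp add: b'_def)
      ultimately have "bad e'" using * unfolding bad_def by metis
      then show False using e(2) e' by blast
    qed
    then have "far b'" using b'O by (simp add: far_def)
    moreover have "b' * r \<in> ?A" using s(3) by (simp add: b'_def e' mult_ac)
    moreover have "b' * f \<in> ?A" if "f \<in> F" for f
      using ideal_mult[OF A OK_mult[OF s(1) OK_power[OF rO, of e']] b(2)[OF that]]
      by (simp add: b'_def mult.assoc)
    ultimately show ?case by blast
  qed
  then obtain b where b: "far b" "\<And>r. r \<in> F \<Longrightarrow> b * r \<in> ?A" by blast
  have bO: "b \<in> OK" using b by (simp add: far_def)
  show ?thesis
  proof
    show "b \<in> OK" by fact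
    have "1 * b \<notin> ?A" using b(1) OK_1 place_1[OF P] unfolding far_def by blast
    then show "b \<notin> ?A" by (simp only: mult_1 not_False_eq_True)
    fix p assume "p \<in> P"
    then obtain f where f: "f \<in> F" "p - f \<in> ?A" using F(3) by blast
    have "b * f + b * (p - f) \<in> ?A" by (rule ideal_add[OF A b(2)[OF f(1)] ideal_mult[OF A bO f(2)]])
    then show "b * p \<in> ?A" by (simp add: algebra_simps)
  qed
qed

text \<open>Integral closedness enters here: if \<open>(b / x) P \<subseteq> P\<close>, then \<open>b / x\<close> is an integer.\<close>

lemma place_divides_principal:
  assumes x: "x \<in> P" "x \<noteq> 0"
  obtains J where "is_ideal J" "(*) x ` OK = ip P J"
proof -
  let ?A = "(*) x ` OK"
  have xO: "x \<in> OK" using ideal_OK[OF I x(1)] .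
  note A = principal_ideal[OF xO]
  obtain b where b: "b \<in> OK" "b \<notin> ?A" "\<And>p. p \<in> P \<Longrightarrow> b * p \<in> ?A"
    using annihilated_by_place[OF x] by metis
  \<comment> \<open>The colon ideal of the multiples of \<open>x\<close> by \<open>P\<close>, the
    only candidate for a cofactor up to enlarging it.\<close>
  define J where "J = {j \<in> OK. \<forall>p\<in>P. j * p \<in> ?A}"
  have J: "is_ideal J"
    by (rule is_idealI)
      (auto simp: J_def OK_closed distrib_right mult.assoc ideal_mult[OF A] ideal_0[OF A] ideal_add[OF A]
        simp del: image_iff)
  have "b \<in> J" "x \<in> J" using b xO ideal_OK[OF I] by (auto simp: J_def)
  have "\<exists>p\<in>P. b * p \<notin> (*) x ` P"
  proof (rule ccontr)
    assume "\<not> ?thesis"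
    then have stable: "b * p \<in> (*) x ` P" if "p \<in> P" for p using that by blast
    obtain G where G: "finite G" "G \<subseteq> P" "P \<subseteq> cx_int.span G" using ideal_finitely_spanned[OF I x] .
    have "\<not> G \<subseteq> {0}"
    proof
      assume "G \<subseteq> {0}"
      then have "cx_int.span G \<subseteq> {0}" by (rule cx_int.span_minimal) (simp add: cx_int.subspace_def)
      then show False using x G(3) by blast
    qed
    moreover have "b / x * g \<in> cx_int.span G" if g: "g \<in> G" for g
    proof -
      obtain p where "p \<in> P" "b * g = x * p" using stable g G(2) by blast
      then show ?thesis using G(3) x(2) by (auto simp: field_simps)
    qed
    ultimately have "algebraic_int (b / x)" using algebraic_int_of_stable_span[OF G(1)] by blast
    then have "b / x \<in> OK" using OK_K[OF b(1)] OK_K[OF xO] K_divide by (simp add: nf_ints_def)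
    then have "x * (b / x) \<in> ?A" by blast
    then show False using b(2) x(2) by simp
  qed
  then obtain p0 where p0: "p0 \<in> P" "b * p0 \<notin> (*) x ` P" by blast
  obtain w where w: "w \<in> OK" "b * p0 = x * w" using b(3)[OF p0(1)] by blast
  then have "w \<notin> P" using p0 by blast
  then obtain r where r: "r \<in> OK" "1 - r * w \<in> P" using place_maximal[OF P w(1)] by blast
  \<comment> \<open>\<open>b * p0\<close> equals \<open>x * w\<close> with \<open>w\<close> a unit
    modulo \<open>P\<close>; multiplying by the inverse \<open>r\<close> of \<open>w\<close>
    recovers \<open>x\<close> up to an error \<open>(1 - r * w) * x\<close>, which lies in the
    product as well.\<close>
  have "p0 * (r * b) + (1 - r * w) * x \<in> ip P J"
    by (intro ip_add ipI p0 r ideal_mult[OF J] \<open>b \<in> J\<close> \<open>x \<in> J\<close>)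
  moreover have "p0 * (r * b) + (1 - r * w) * x = x"
  proof -
    have "p0 * (r * b) = r * (b * p0)" by (simp add: mult_ac)
    then show ?thesis by (simp add: w(2) algebra_simps)
  qed
  ultimately have xPJ: "x \<in> ip P J" by simp
  have "?A \<subseteq> ip P J" using principal_subset[OF R.ideal_prod_is_ideal[OF I J] xPJ] .
  moreover have "ip P J \<subseteq> ?A"
  proof (rule ip_subset)
    fix p j assume "p \<in> P" "j \<in> J"
    then show "p * j \<in> ?A" by (subst mult.commute) (simp add: J_def)
  qed (rule ideal_add[OF A])
  ultimately show ?thesis using that J by blast
qed

text \<open>The exponents in the supremum are exactly 0 and 1:
  \<open>place_divides_principal\<close> provides 1, and a larger one would put \<open>x\<close>
  into the square of \<open>P\<close>.\<close>

lemma int_val_eq_1: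
  assumes "x \<in> P" "x \<notin> ip P P"
  shows "int_val K P x = 1"
proof -
  have x0: "x \<noteq> 0" using assms ideal_0[OF R.ideal_prod_is_ideal[OF I I]] by blast
  have xO: "x \<in> OK" using ideal_OK[OF I assms(1)] .
  let ?D = "\<lambda>n. ipow P n divides\<^bsub>ideals_set (int_ring K)\<^esub> PIdl\<^bsub>int_ring K\<^esub> x"
  have "?D 0"
    unfolding divides_iff PIdl_eq ipow_0
    using principal_ideal[OF xO] R.ideal_prod_one[OF principal_ideal[OF xO]]
      R.ideal_prod_commute[OF principal_ideal[OF xO] R.oneideal] by auto
  moreover have "?D 1"
    unfolding divides_iff PIdl_eq ipow_1[OF I] using place_divides_principal[OF assms(1) x0] by metis
  moreover have "\<not> ?D n" if "n \<ge> 2" for n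
  proof
    assume "?D n"
    then obtain J where J: "is_ideal J" "(*) x ` OK = ip (ipow P n) J" by (auto simp: divides_iff PIdl_eq)
    have "x \<in> (*) x ` OK" using OK_1 by force
    then have "x \<in> ipow P n" using R.ideal_prod_inter[OF ipow_ideal[OF I] J(1)] J(2) by blast
    then show False using ipow_le_2[OF I that] assms(2) by blast
  qed
  moreover have "n = 0 \<or> n = 1 \<or> n \<ge> 2" for n :: nat by linarith
  ultimately have "{n. ?D n} = {0, 1}" by blast
  then show ?thesis unfolding int_val_def ideal_exponent_def ipow_def[symmetric]
    by (simp add: zero_enat_def one_enat_def sup_max)
qed

text \<open>If \<open>P\<close> were contained in its square, multiplying by the cofactor
  \<open>J\<close> of \<open>x\<close> would put \<open>x\<close> into \<open>x\<close> times
  \<open>P\<close>, and cancelling \<open>x\<close> would give 1 in \<open>P\<close>.\<close>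

lemma place_uniformizer:
  obtains \<pi> where "\<pi> \<in> P" "\<pi> \<notin> ip P P"
proof -
  obtain x where x: "x \<in> P" "x \<noteq> 0" using place_nonzero[OF P] .
  have xO: "x \<in> OK" using ideal_OK[OF I x(1)] .
  obtain J where J: "is_ideal J" "(*) x ` OK = ip P J" using place_divides_principal[OF x] .
  have "\<not> P \<subseteq> ip P P"
  proof
    assume sub: "P \<subseteq> ip P P"
    have add: "u + v \<in> (*) x ` P" if "u \<in> (*) x ` P" "v \<in> (*) x ` P" for u v
      using that ideal_add[OF I] by (auto simp: distrib_left[symmetric])
    have "ip P J \<subseteq> (*) x ` P"
    proof (rule ip_subset[OF _ add])
      fix u j assume "u \<in> P" and j: "j \<in> J"
      have "ip P P \<subseteq> {u. u * j \<in> (*) x ` P}"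
      proof (rule ip_subset)
        fix p q assume pq: "p \<in> P" "q \<in> P"
        obtain y where y: "y \<in> OK" "q * j = x * y" using ipI[OF pq(2) j] unfolding J(2)[symmetric] by blast
        have "p * q * j = x * (p * y)" using y(2) by (simp add: mult_ac)
        then show "p * q \<in> {u. u * j \<in> (*) x ` P}"
          using imageI[OF ideal_mult'[OF I y(1) pq(1)], of "(*) x"] by (simp only: mem_Collect_eq)
      qed (use add in \<open>auto simp: distrib_right simp del: image_iff\<close>)
      then show "u * j \<in> (*) x ` P" using sub \<open>u \<in> P\<close> by blast
    qed
    moreover have "x * 1 \<in> (*) x ` OK" using OK_1 by blast
    ultimately obtain p where "p \<in> P" "x * 1 = x * p" using J(2) by blast
    then show False using x(2) place_1[OF P] by simp
  qed
  then show ?thesis using that by blast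
qed

section \<open>Residue systems, the norm, and Fermat's theorem\<close>

lemma norm_transversal:
  obtains F where "finite F" "incongruent P F" "\<And>s. s \<in> OK \<Longrightarrow> \<exists>f\<in>F. s - f \<in> P" "card F = ideal_norm K P"
proof -
  obtain x where x: "x \<in> P" "x \<noteq> 0" using place_nonzero[OF P] .
  obtain F where F: "F \<subseteq> OK" "finite F" "incongruent P F" "\<And>s. s \<in> OK \<Longrightarrow> \<exists>f\<in>F. s - f \<in> P"
    using representatives[OF I x subset_refl] by metis
  define c where "c f = P +>\<^bsub>int_ring K\<^esub> f" for f
  have c: "c f = {h + f |h. h \<in> P}" for f by (auto simp: c_def a_r_coset_def')
  have c_eq: "c s = c f \<longleftrightarrow> s - f \<in> P" for s f
  proof
    assume "c s = c f"
    moreover have "s \<in> c s" using ideal_0[OF I] by (force simp: c)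
    ultimately show "s - f \<in> P" by (auto simp: c)
  next
    assume d: "s - f \<in> P"
    show "c s = c f"
    proof (intro equalityI subsetI)
      fix u assume "u \<in> c s"
      then obtain h where "h \<in> P" "u = h + s" by (auto simp: c)
      then have "u = (h + (s - f)) + f" "h + (s - f) \<in> P" using d ideal_add[OF I] by auto
      then show "u \<in> c f" unfolding c by blast
    next
      fix u assume "u \<in> c f"
      then obtain h where "h \<in> P" "u = h + f" by (auto simp: c)
      then have "u = (h - (s - f)) + s" "h - (s - f) \<in> P" using d ideal_diff[OF I] by auto
      then show "u \<in> c s" unfolding c by blast
    qed
  qed
  have "inj_on c F" using F(3) by (auto simp: inj_on_def c_eq incongruent_def)
  moreover have "carrier (int_ring K Quot P) = c ` F"
  proof -
    have "carrier (int_ring K Quot P) = c ` OK" by (auto simp: FactRing_def A_RCOSETS_def' c_def)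
    also have "\<dots> = c ` F" using F(1,4) c_eq by (auto simp: image_iff)
    finally show ?thesis .
  qed
  ultimately have "card F = ideal_norm K P" by (simp add: ideal_norm_def card_image)
  then show ?thesis using that F by blast
qed

lemma incongruent_le_norm:
  assumes "incongruent P Y"
  shows "finite Y" "card Y \<le> ideal_norm K P"
proof -
  obtain F where F: "finite F" "\<And>s. s \<in> OK \<Longrightarrow> \<exists>f\<in>F. s - f \<in> P" "card F = ideal_norm K P"
    using norm_transversal by metis
  have "\<forall>y\<in>Y. \<exists>f\<in>F. y - f \<in> P" using F(2) assms by (auto simp: incongruent_def)
  then obtain g where g: "\<And>y. y \<in> Y \<Longrightarrow> g y \<in> F \<and> y - g y \<in> P" by metis
  have "inj_on g Y"
  proof (rule inj_onI)
    fix y y' assume y: "y \<in> Y" "y' \<in> Y" "g y = g y'"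
    have "(y - g y) - (y' - g y') \<in> P" using ideal_diff[OF I] g y(1,2) by blast
    then show "y = y'" using assms y by (simp add: incongruent_def)
  qed
  then show "finite Y" "card Y \<le> ideal_norm K P"
    using g F inj_on_finite[of g Y F] card_inj_on_le[of g Y F] by auto
qed

lemma norm_ge_2: "ideal_norm K P \<ge> 2"
proof -
  have "incongruent P {0, 1}"
    using place_1[OF P] ideal_diff[OF I ideal_0[OF I], of "-1"] OK_0 OK_1 by (auto simp: incongruent_def)
  from incongruent_le_norm(2)[OF this] show ?thesis by simp
qed

text \<open>Two-digit expansions \<open>f + g * \<pi>\<close> with digits in a residue system. The
  class modulo \<open>P\<close> determines \<open>f\<close>; then \<open>(g - g') * \<pi>\<close> is
  in the square of \<open>P\<close> while \<pi> is not, so \<open>g - g'\<close> lies in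
  \<open>P\<close> by primariness.\<close>

lemma incongruent_square:
  obtains Y where "finite Y" "incongruent (ip P P) Y" "card Y = ideal_norm K P ^ 2"
proof -
  obtain F where F: "finite F" "incongruent P F" "card F = ideal_norm K P" using norm_transversal by metis
  obtain \<pi> where \<pi>: "\<pi> \<in> P" "\<pi> \<notin> ip P P" using place_uniformizer .
  note I2 = R.ideal_prod_is_ideal[OF I I]
  have FO: "f \<in> OK" if "f \<in> F" for f using that F(2) by (auto simp: incongruent_def)
  define h where "h = (\<lambda>(f,g). f + g * \<pi>)"
  have key: "f = f' \<and> g = g'" if fg: "f \<in> F" "f' \<in> F" "g \<in> F" "g' \<in> F"
    and d: "h (f, g) - h (f', g') \<in> ip P P" for f f' g g'
  proof -
    have dP: "h (f, g) - h (f', g') \<in> P" using d R.ideal_prod_inter[OF I I] by blast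
    have "g - g' \<in> OK" using fg FO by (intro OK_diff)
    then have "h (f, g) - h (f', g') - (g - g') * \<pi> \<in> P"
      by (intro ideal_diff[OF I dP] ideal_mult[OF I] \<pi>)
    moreover have "h (f, g) - h (f', g') - (g - g') * \<pi> = f - f'" by (simp add: h_def algebra_simps)
    ultimately have f: "f = f'" using F(2) fg by (auto simp: incongruent_def)
    have "g - g' \<in> P"
    proof (rule ccontr)
      assume n: "g - g' \<notin> P"
      have "(g - g') * \<pi> \<in> ipow P 2" using d f by (simp add: h_def ipow_2[OF I] algebra_simps)
      from place_power_primary[OF P _ n _ this] show False
        using \<pi> ideal_OK[OF I \<pi>(1)] fg FO by (auto simp: ipow_2[OF I] OK_diff)
    qed
    then show ?thesis using f F(2) fg by (auto simp: incongruent_def)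
  qed
  have inj: "inj_on h (F \<times> F)"
  proof (rule inj_onI, clarify)
    fix f g f' g' assume "f \<in> F" "g \<in> F" "f' \<in> F" "g' \<in> F" "h (f, g) = h (f', g')"
    then show "f = f' \<and> g = g'" using key[of f f' g g'] ideal_0[OF I2] by simp
  qed
  have "incongruent (ip P P) (h ` (F \<times> F))"
    unfolding incongruent_def
  proof (intro conjI ballI impI)
    show "h ` (F \<times> F) \<subseteq> OK" using FO ideal_OK[OF I \<pi>(1)] by (auto simp: h_def OK_closed)
  next
    fix u v assume "u \<in> h ` (F \<times> F)" "v \<in> h ` (F \<times> F)" and d: "u - v \<in> ip P P"
    then obtain f g f' g' where "f \<in> F" "g \<in> F" "f' \<in> F" "g' \<in> F" "u = h (f, g)" "v = h (f', g')" by blast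
    then show "u = v" using key[of f f' g g'] d by blast
  qed
  moreover have "card (h ` (F \<times> F)) = ideal_norm K P ^ 2"
    using card_image[OF inj] F by (simp add: card_cartesian_product power2_eq_square)
  ultimately show ?thesis using that[of "h ` (F \<times> F)"] F(1) by simp
qed

text \<open>Applied to \<open>f + 1\<close> and to \<open>a * f\<close>: summing or multiplying over
  a residue system then compares the system with itself.\<close>

lemma residue_permutation:
  assumes F: "finite F" "incongruent P F"
    and g: "\<And>f. f \<in> F \<Longrightarrow> \<exists>f'\<in>F. g f - f' \<in> P"
    and inj: "\<And>f f'. f \<in> F \<Longrightarrow> f' \<in> F \<Longrightarrow> g f - g f' \<in> P \<Longrightarrow> f - f' \<in> P"
  obtains h where "bij_betw h F F" "\<And>f. f \<in> F \<Longrightarrow> g f - h f \<in> P"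
proof -
  obtain h where h: "\<And>f. f \<in> F \<Longrightarrow> h f \<in> F \<and> g f - h f \<in> P" using g by metis
  have "inj_on h F"
  proof (rule inj_onI)
    fix f f' assume f: "f \<in> F" "f' \<in> F" "h f = h f'"
    have "(g f - h f) - (g f' - h f') \<in> P" using ideal_diff[OF I] h f(1,2) by blast
    then show "f = f'" using inj[OF f(1,2)] F(2) f by (simp add: incongruent_def)
  qed
  moreover have "h ` F \<subseteq> F" using h by blast
  ultimately have "bij_betw h F F" using F(1) by (simp add: bij_betw_def endo_inj_surj)
  then show ?thesis using that h by blast
qed

text \<open>Translation by 1 permutes the classes, so the sums of \<open>f\<close> and of
  \<open>f + 1\<close> over a residue system agree modulo \<open>P\<close>; they differ by the
  number of classes.\<close>

lemma norm_in_place: "of_nat (ideal_norm K P) \<in> P"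
proof -
  obtain F where F: "finite F" "incongruent P F" "\<And>s. s \<in> OK \<Longrightarrow> \<exists>f\<in>F. s - f \<in> P" "card F = ideal_norm K P"
    using norm_transversal by metis
  have FO: "f \<in> OK" if "f \<in> F" for f using that F(2) by (auto simp: incongruent_def)
  obtain h where h: "bij_betw h F F" "\<And>f. f \<in> F \<Longrightarrow> (f + 1) - h f \<in> P"
  proof (rule residue_permutation[OF F(1,2), of "\<lambda>f. f + 1"])
    show "\<exists>f'\<in>F. f + 1 - f' \<in> P" if "f \<in> F" for f using F(3)[OF OK_add[OF FO[OF that] OK_1]] .
    show "f - f' \<in> P" if "(f + 1) - (f' + 1) \<in> P" for f f' using that by simp
  qed blast
  have "(\<Sum>f\<in>F. (f + 1) - h f) \<in> P" by (rule ideal_sum[OF I]) (rule h(2))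
  moreover have "(\<Sum>f\<in>F. h f) = (\<Sum>f\<in>F. f)" by (rule sum.reindex_bij_betw[OF h(1)])
  ultimately show ?thesis using F(4) by (simp add: sum_subtractf sum.distrib)
qed

lemma fermat_place:
  assumes a: "a \<in> OK" "a \<notin> P"
  shows "a ^ (ideal_norm K P - 1) - 1 \<in> P"
proof -
  obtain F0 where F0: "finite F0" "incongruent P F0" "\<And>s. s \<in> OK \<Longrightarrow> \<exists>f\<in>F0. s - f \<in> P"
      "card F0 = ideal_norm K P" using norm_transversal by metis
  \<comment> \<open>The representative of the zero class; what remains represents the nonzero
    classes.\<close>
  obtain f0 where f0: "f0 \<in> F0" "0 - f0 \<in> P" using F0(3)[OF OK_0] by blast
  then have f0P: "f0 \<in> P" using ideal_diff[OF I ideal_0[OF I] f0(2)] by simp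
  define F where "F = F0 - {f0}"
  have F: "finite F" "incongruent P F" using F0(1,2) by (auto simp: F_def incongruent_def)
  have FO: "f \<in> OK" if "f \<in> F" for f using that F(2) by (auto simp: incongruent_def)
  have FP: "f \<notin> P" if "f \<in> F" for f
    using that f0 f0P F0(2) ideal_diff[OF I, of f f0] by (auto simp: F_def incongruent_def)
  have neg: "x \<in> P" if "- x \<in> P" for x using ideal_diff[OF I ideal_0[OF I] that] by simp
  obtain h where h: "bij_betw h F F" "\<And>f. f \<in> F \<Longrightarrow> a * f - h f \<in> P"
  proof (rule residue_permutation[OF F, of "\<lambda>f. a * f"])
    fix f assume f: "f \<in> F"
    obtain f' where f': "f' \<in> F0" "a * f - f' \<in> P" using F0(3)[OF OK_mult[OF a(1) FO[OF f]]] by blast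
    have "f' \<noteq> f0"
    proof
      assume "f' = f0"
      then have "a * f \<in> P" using ideal_add[OF I f'(2) f0P] by simp
      then show False using place_prime[OF P a(1) FO[OF f]] a(2) FP[OF f] by blast
    qed
    then show "\<exists>f'\<in>F. a * f - f' \<in> P" using f' by (auto simp: F_def)
  next
    fix f f' assume f: "f \<in> F" "f' \<in> F" "a * f - a * f' \<in> P"
    then show "f - f' \<in> P" using place_prime[OF P a(1), of "f - f'"] a(2) FO OK_diff
      by (auto simp: right_diff_distrib)
  qed blast
  have hF: "h f \<in> F" if "f \<in> F" for f using h(1) that by (auto simp: bij_betw_def)
  have "(\<Prod>f\<in>F. a * f) - (\<Prod>f\<in>F. h f) \<in> P"
    by (rule prod_congruent[OF I]) (use a FO h hF OK_mult in auto)
  moreover have "(\<Prod>f\<in>F. h f) = \<Prod>F" by (rule prod.reindex_bij_betw[OF h(1)])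
  moreover have "(\<Prod>f\<in>F. a * f) = a ^ card F * \<Prod>F" by (simp add: prod.distrib)
  ultimately have "(a ^ card F - 1) * \<Prod>F \<in> P" by (simp add: algebra_simps)
  moreover have "\<Prod>F \<notin> P"
  proof -
    have "\<Prod>A \<notin> P \<and> \<Prod>A \<in> OK" if "finite A" "A \<subseteq> F" for A
      using that by induction (use place_prime[OF P] place_1[OF P] FO FP OK_1 OK_mult in auto)
    then show ?thesis using F(1) by blast
  qed
  moreover have "\<Prod>F \<in> OK" "a ^ card F - 1 \<in> OK" using FO a OK_prod[of F "\<lambda>f. f"] by (auto intro!: OK_diff OK_power OK_1)
  moreover have "card F = ideal_norm K P - 1" using F0 f0 by (simp add: F_def)
  ultimately show ?thesis using place_prime[OF P] by metis
qed

text \<open>The multiplicative order of \<open>a\<close> modulo \<open>P\<close>.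
  \<open>LEAST\<close> says nothing if there is no such exponent, so the lemmas below take a witness
  \<open>n\<close>.\<close>

definition place_ord :: "complex \<Rightarrow> nat" where
  "place_ord a = (LEAST m. m > 0 \<and> a ^ m - 1 \<in> P)"

lemma place_ord:
  assumes a: "a \<in> OK" and n: "n > 0" "a ^ n - 1 \<in> P"
  shows "place_ord a > 0" "a ^ place_ord a - 1 \<in> P" "a ^ e - 1 \<in> P \<longleftrightarrow> place_ord a dvd e" "a \<notin> P"
proof -
  let ?m = "place_ord a"
  have *: "?m > 0 \<and> a ^ ?m - 1 \<in> P"
    unfolding place_ord_def by (rule LeastI[of _ n]) (use n in simp)
  then show "?m > 0" "a ^ ?m - 1 \<in> P" by auto
  show "a \<notin> P"
  proof
    assume "a \<in> P"
    then have "a ^ n \<in> P" using n(1) ideal_mult[OF I OK_power[OF a, of "n - 1"]] power_minus_mult[of n a] by metis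
    then show False using ideal_diff[OF I _ n(2)] place_1[OF P] by force
  qed
  then have aP: "a ^ i \<notin> P" for i using place_power[OF P a] by blast
  have mult: "a ^ (?m * t) - 1 \<in> P" for t
  proof -
    have "prod (\<lambda>_. a ^ ?m) {..<t} - prod (\<lambda>_. 1) {..<t} \<in> P"
      by (rule prod_congruent[OF I]) (use a * OK_power OK_1 in auto)
    then show ?thesis by (simp add: power_mult)
  qed
  show "a ^ e - 1 \<in> P \<longleftrightarrow> ?m dvd e"
  proof
    assume e: "a ^ e - 1 \<in> P"
    have "a ^ e = a ^ (?m * (e div ?m)) * a ^ (e mod ?m)" by (simp flip: power_add)
    then have "(a ^ e - 1) - a ^ (e mod ?m) * (a ^ (?m * (e div ?m)) - 1) = a ^ (e mod ?m) - 1"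
      by (simp add: algebra_simps)
    then have r: "a ^ (e mod ?m) - 1 \<in> P"
      using ideal_diff[OF I e ideal_mult[OF I OK_power[OF a] mult]] by metis
    have "e mod ?m = 0"
    proof (rule ccontr)
      assume "e mod ?m \<noteq> 0"
      then have "e mod ?m > 0 \<and> a ^ (e mod ?m) - 1 \<in> P" using r by blast
      then have "(LEAST m. m > 0 \<and> a ^ m - 1 \<in> P) \<le> e mod ?m" by (rule Least_le)
      then have "?m \<le> e mod ?m" by (simp only: place_ord_def)
      moreover have "e mod ?m < ?m" using * by simp
      ultimately show False by simp
    qed
    then show "?m dvd e" by auto
  qed (use mult in auto)
qed

lemma place_ord_dvd_norm:
  assumes "a \<in> OK" "n > 0" "a ^ n - 1 \<in> P"
  shows "place_ord a dvd ideal_norm K P - 1"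
  using place_ord[OF assms] fermat_place[OF assms(1)] by blast

text \<open>With \<open>m\<close> the order, \<open>a ^ m - 1\<close> divides
  \<open>a ^ n - 1\<close>, so it is not in the square of \<open>P\<close>. Write
  \<open>q - 1 = m * t\<close> for the norm \<open>q\<close>. Then \<open>a ^ (q - 1) - 1\<close> is
  \<open>a ^ m - 1\<close> times a geometric sum congruent to \<open>t\<close>, which is a unit
  modulo \<open>P\<close> because \<open>m * t\<close> is -1 there.\<close>

lemma non_wieferich_criterion:
  assumes a: "a \<in> OK" and n: "n > 0" "a ^ n - 1 \<in> P" "a ^ n - 1 \<notin> ip P P"
  shows "non_wieferich_place K a P"
proof -
  let ?m = "place_ord a" and ?q = "ideal_norm K P"
  note I2 = R.ideal_prod_is_ideal[OF I I]
  note m = place_ord[OF a n(1,2)]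
  have geom: "a ^ (?m * t) - 1 = (a ^ ?m - 1) * (\<Sum>i<t. (a ^ ?m) ^ i)" for t
    by (simp add: power_mult power_diff_1_eq)
  have sumO: "(\<Sum>i<t. (a ^ ?m) ^ i) \<in> OK" for t using a by (intro OK_closed)
  obtain t0 where "n = ?m * t0" using m(3) n(2) by blast
  then have m2: "a ^ ?m - 1 \<notin> ip P P" using geom[of t0] ideal_mult'[OF I2 sumO] n(3) by metis
  obtain t where t: "?q - 1 = ?m * t" using place_ord_dvd_norm[OF a n(1,2)] by blast
  define s where "s = (\<Sum>i<t. (a ^ ?m) ^ i)"
  have "s \<notin> P"
  proof
    assume "s \<in> P"
    have "(a ^ ?m) ^ i - 1 \<in> P" for i using m(3)[of "?m * i"] by (simp add: power_mult)
    then have "(\<Sum>i<t. (a ^ ?m) ^ i - 1) \<in> P" by (intro ideal_sum[OF I])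
    then have "s - of_nat t \<in> P" by (simp add: s_def sum_subtractf)
    then have "of_nat t \<in> P" using ideal_diff[OF I \<open>s \<in> P\<close>] by force
    then have "of_nat ?m * of_nat t \<in> P" by (intro ideal_mult[OF I] OK_of_nat)
    then have "of_nat ?q - of_nat (?q - 1) \<in> P"
      unfolding t using ideal_diff[OF I norm_in_place] by (metis of_nat_mult)
    then show False using place_1[OF P] norm_ge_2 by (simp add: of_nat_diff)
  qed
  have e: "a ^ (?q - 1) - 1 = s * (a ^ ?m - 1)" unfolding t geom s_def by (simp add: mult.commute)
  have "a ^ (?q - 1) - 1 \<in> P" by (rule fermat_place[OF a m(4)])
  moreover have "a ^ (?q - 1) - 1 \<notin> ip P P"
  proof
    assume "a ^ (?q - 1) - 1 \<in> ip P P"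
    then have "s * (a ^ ?m - 1) \<in> ipow P 2" unfolding e ipow_2[OF I] .
    from place_power_primary[OF P _ \<open>s \<notin> P\<close> _ this] show False
      using m2 sumO a by (simp add: s_def ipow_2[OF I] OK_closed)
  qed
  ultimately have "int_val K P (a ^ (?q - 1) - 1) = 1" by (rule int_val_eq_1)
  then show ?thesis using P by (simp add: non_wieferich_place_def)
qed

end

end

section \<open>A lower bound for the number of primes\<close>

text \<open>\<open>L\<close> is the least common multiple of the numbers up to \<open>n\<close>,
  built from the largest prime powers not exceeding \<open>n\<close>; each of them is at most
  \<open>n\<close>.\<close>

lemma prime_power_envelope:
  fixes n :: nat
  obtains L where "L > 0" "L \<le> n ^ card {p. Factorial_Ring.prime p \<and> p \<le> n}" "\<And>i. 1 \<le> i \<Longrightarrow> i \<le> n \<Longrightarrow> i dvd L"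
proof -
  let ?S = "{p. Factorial_Ring.prime p \<and> p \<le> n}"
  have fin: "finite ?S" by (rule finite_subset[of _ "{..n}"]) auto
  define e where "e p = Max {e. p ^ e \<le> n}" for p
  have finE: "finite {m. p ^ m \<le> n}" if "Factorial_Ring.prime p" for p
  proof (rule finite_subset[of _ "{..n}"])
    have "m < p ^ m" for m using prime_gt_1_nat[OF that] power_gt_expt[of p m] by simp
    then show "{m. p ^ m \<le> n} \<subseteq> {..n}" using less_le_trans less_imp_le by fastforce
  qed simp
  define L where "L = (\<Prod>p\<in>?S. p ^ e p)"
  have "L > 0" unfolding L_def using prime_gt_0_nat by (auto intro!: prod_pos)
  moreover have "L \<le> n ^ card ?S"
  proof -
    have "p ^ e p \<le> n" if "p \<in> ?S" for p
    proof -
      have "1 \<le> n" using that prime_gt_0_nat[of p] by auto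
      then have "0 \<in> {m. p ^ m \<le> n}" by simp
      then have "{m. p ^ m \<le> n} \<noteq> {}" by blast
      then have "e p \<in> {m. p ^ m \<le> n}" unfolding e_def using finE that by (intro Max_in) simp_all
      then show ?thesis by simp
    qed
    then have "L \<le> (\<Prod>p\<in>?S. n)" unfolding L_def by (intro prod_mono) auto
    then show ?thesis by simp
  qed
  moreover have "i dvd L" if i: "1 \<le> i" "i \<le> n" for i
  proof (rule multiplicity_le_imp_dvd)
    show "i \<noteq> 0" using i by simp
    fix p :: nat assume p: "Factorial_Ring.prime p"
    have d: "p ^ multiplicity p i dvd i" by (rule multiplicity_dvd)
    show "multiplicity p i \<le> multiplicity p L"
    proof (cases "multiplicity p i = 0")
      case False
      then have "p dvd i" using not_dvd_imp_multiplicity_0[of p i] by metis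
      then have "p \<le> i" using i by (intro dvd_imp_le) simp_all
      then have "p \<in> ?S" using p i by simp
      moreover have "p ^ multiplicity p i \<le> i" using d i by (intro dvd_imp_le) simp_all
      then have "p ^ multiplicity p i \<le> n" using i by simp
      then have "multiplicity p i \<le> e p" unfolding e_def by (intro Max_ge finE[OF p]) simp
      ultimately show ?thesis
        unfolding L_def using fin p by (subst multiplicity_prod_prime_powers) simp_all
    qed simp
  qed
  ultimately show ?thesis using that by blast
qed

text \<open>The recurrence \<open>1 / ((m + 1) (n choose m + 1)) = 1 / (m (n - 1 choose m)) - 1 / (m (n choose m))\<close> of
  the Leibniz harmonic triangle.\<close>

lemma binomial_dvd_common_multiple:
  fixes L n m :: nat
  assumes "1 \<le> m" "m \<le> n" "\<And>i. 1 \<le> i \<Longrightarrow> i \<le> n \<Longrightarrow> i dvd L"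
  shows "real L / (real m * real (n choose m)) \<in> \<int>"
  using assms
proof (induction m arbitrary: n rule: nat_induct_at_least[of 1])
  case base
  then obtain k where "L = n * k" by (metis dvdE order_refl)
  then show ?case using base by simp
next
  case (Suc m)
  then obtain n' where n: "n = Suc n'" by (cases n) auto
  have m: "1 \<le> m" "m \<le> n'" using Suc n by auto
  let ?c = "real (n' choose m)"
  have pos: "?c > 0" using m by simp
  have "real L / (real m * ?c) - real L / (real m * real (n choose m)) \<in> \<int>"
    by (intro Ints_diff Suc.IH) (use Suc.prems n m in auto)
  moreover have "real L / (real m * ?c) - real L / (real m * real (n choose m)) =
      real L / (real (Suc m) * real (n choose Suc m))"
  proof -
    have a: "real (Suc m) * real (n choose Suc m) = real n * ?c"
      unfolding n of_nat_mult[symmetric] by (metis Suc_times_binomial_eq mult.commute)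
    have "(n - m) * (n choose m) = n * (n' choose m)"
      using binomial_absorb_comp[of n m] n by simp
    then have "real (n - m) * real (n choose m) = real n * ?c" by (metis of_nat_mult)
    moreover have nm: "real (n - m) = real n - real m" "real n - real m > 0" using m n by auto
    ultimately have b: "real (n choose m) = real n * ?c / (real n - real m)" by (simp add: field_simps)
    have key: "l / (M * c) - l / (M * (N * c / D)) = l / (N * c)"
      if "M > 0" "D > 0" "c > 0" "N = M + D" for l M N c D :: real
    proof -
      have "l / (M * (N * c / D)) = l * D / (M * N * c)" using that by simp
      moreover have "l / (M * c) = l * N / (M * N * c)" using that by simp
      ultimately have "l / (M * c) - l / (M * (N * c / D)) = l * (N - D) / (M * N * c)"
        by (simp add: diff_divide_distrib right_diff_distrib)
      also have "\<dots> = l / (N * c)" using that by simp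
      finally show ?thesis .
    qed
    show ?thesis unfolding a b by (rule key) (use pos nm m in auto)
  qed
  ultimately show ?case by simp
qed

text \<open>Each \<open>n * (n - 1 choose j)\<close> divides \<open>L\<close>, hence is at most
  \<open>L\<close>. Summing over the \<open>n\<close> values of \<open>j\<close> gives
  \<open>2 ^ (n - 1) \<le> L\<close>, to be compared with the upper bound for \<open>L\<close>; the
  constant comes from \<open>n - 1 \<ge> n / 2\<close>.\<close>

lemma chebyshev_lower:
  fixes n :: nat
  assumes "n \<ge> 2"
  shows "real (card {p. Factorial_Ring.prime p \<and> p \<le> n}) \<ge> ln 2 / 2 * (real n / ln (real n))"
proof -
  obtain L where L: "L > 0" "L \<le> n ^ card {p. Factorial_Ring.prime p \<and> p \<le> n}" "\<And>i. 1 \<le> i \<Longrightarrow> i \<le> n \<Longrightarrow> i dvd L"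
    using prime_power_envelope by metis
  obtain n' where n: "n = Suc n'" using assms by (cases n) auto
  have "real n * real (n' choose j) \<le> real L" if "j \<le> n'" for j
  proof -
    have "real L / (real (Suc j) * real (n choose Suc j)) \<in> \<int>"
      by (rule binomial_dvd_common_multiple) (use that n L in auto)
    moreover have e: "real (Suc j) * real (n choose Suc j) = real n * real (n' choose j)"
      unfolding n of_nat_mult[symmetric] by (metis Suc_times_binomial_eq mult.commute)
    moreover have pos: "real n * real (n' choose j) > 0" using that n by simp
    ultimately obtain z where z: "real L / (real n * real (n' choose j)) = of_int z"
      by (metis Ints_cases)
    moreover have "real L / (real n * real (n' choose j)) > 0" using pos L(1) by (intro divide_pos_pos) auto
    ultimately have "real L / (real n * real (n' choose j)) \<ge> 1" by simp
    then show ?thesis using pos by (simp only: le_divide_eq_1_pos)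
  qed
  then have "(\<Sum>j\<le>n'. real n * real (n' choose j)) \<le> (\<Sum>j\<le>n'. real L)" by (intro sum_mono) auto
  then have "real n * real (\<Sum>j\<le>n'. n' choose j) \<le> real n * real L" by (simp add: n sum_distrib_left)
  then have "2 ^ n' \<le> L" using n by (simp add: choose_row_sum)
  then have "2 ^ n' \<le> n ^ card {p. Factorial_Ring.prime p \<and> p \<le> n}" using L(2) by linarith
  then have "real (2 ^ n') \<le> real (n ^ card {p. Factorial_Ring.prime p \<and> p \<le> n})" by (simp only: of_nat_le_iff)
  then have "ln (2 ^ n' :: real) \<le> ln (real n ^ card {p. Factorial_Ring.prime p \<and> p \<le> n})"
    using assms by (subst ln_le_cancel_iff) auto
  then have "real n' * ln 2 \<le> real (card {p. Factorial_Ring.prime p \<and> p \<le> n}) * ln n"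
    using assms by (simp add: ln_realpow)
  moreover have "real n / 2 * ln 2 \<le> real n' * ln 2" using assms n by (intro mult_right_mono) auto
  ultimately have "real n / 2 * ln 2 \<le> real (card {p. Factorial_Ring.prime p \<and> p \<le> n}) * ln n" by linarith
  moreover have "ln n > 0" using assms by simp
  ultimately have "(real n / 2 * ln 2) / ln n \<le> real (card {p. Factorial_Ring.prime p \<and> p \<le> n})"
    by (simp only: pos_divide_le_eq)
  then show ?thesis by (simp add: mult_ac)
qed

section \<open>Places dividing a given integer\<close>

context galois_field
begin

lemma places_comaximal:
  assumes P: "P \<in> finite_places K" and Q: "Q \<in> finite_places K" and "P \<noteq> Q"
  obtains u where "u \<in> ip Q Q" "1 - u \<in> ip P P"
proof -
  note I = place_ideal[OF P] place_ideal[OF Q]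
  have "\<exists>w\<in>Q. w \<notin> P"
  proof (rule ccontr)
    assume "\<not> ?thesis"
    then have sub: "Q \<subseteq> P" by blast
    then obtain p where p: "p \<in> P" "p \<notin> Q" using \<open>P \<noteq> Q\<close> by blast
    have pO: "p \<in> OK" using ideal_OK[OF I(1) p(1)] .
    obtain r where r: "r \<in> OK" "1 - r * p \<in> Q" using place_maximal[OF Q pO p(2)] by blast
    have "(1 - r * p) + r * p \<in> P" using sub r by (intro ideal_add[OF I(1)] ideal_mult[OF I(1)] p) auto
    then show False using place_1[OF P] by simp
  qed
  then obtain w where w: "w \<in> Q" "w \<notin> P" by blast
  have wO: "w \<in> OK" using ideal_OK[OF I(2) w(1)] .
  obtain r where r: "r \<in> OK" "1 - r * w \<in> P" using place_maximal[OF P wO w(2)] by blast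
  define u where "u = r * w"
  define v where "v = 1 - r * w"
  have uQ: "u \<in> Q" unfolding u_def by (rule ideal_mult[OF I(2) r(1) w(1)])
  have vP: "v \<in> P" using r by (simp add: v_def)
  have uv: "u \<in> OK" "v \<in> OK" "u + v = 1" using ideal_OK[OF I(2) uQ] ideal_OK[OF I(1) vP] by (auto simp: u_def v_def)
  show ?thesis
  proof
    \<comment> \<open>Expand the cube of \<open>u + v = 1\<close>: two of the four terms contain
      \<open>u * u\<close>, the other two \<open>v * v\<close>.\<close>
    show "(u * u) * (u + of_nat 3 * v) \<in> ip Q Q"
      by (intro ideal_mult'[OF R.ideal_prod_is_ideal[OF I(2,2)]] ipI uQ OK_closed uv)
    have "(v * v) * (v + of_nat 3 * u) \<in> ip P P"
      by (intro ideal_mult'[OF R.ideal_prod_is_ideal[OF I(1,1)]] ipI vP OK_closed uv)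
    moreover have "(v * v) * (v + of_nat 3 * u) = (u + v) ^ 3 - (u * u) * (u + of_nat 3 * v)"
      by (simp add: power3_eq_cube algebra_simps)
    ultimately show "1 - (u * u) * (u + of_nat 3 * v) \<in> ip P P" by (simp add: uv)
  qed
qed

text \<open>\<open>e i\<close> is 1 modulo \<open>I i\<close> and 0 modulo the other ideals, so the
  sums \<open>y f\<close> realise all choices of residues. They remain distinct modulo
  \<open>x\<close> because \<open>x\<close> lies in every \<open>I i\<close>; no product of the
  ideals has to be formed.\<close>

lemma chinese_remainder_incongruent:
  fixes I :: "'i \<Rightarrow> complex set"
  assumes S: "finite S"
    and I: "\<And>i. i \<in> S \<Longrightarrow> is_ideal (I i)" "\<And>i. i \<in> S \<Longrightarrow> x \<in> I i"
    and X: "\<And>i. i \<in> S \<Longrightarrow> finite (X i)" "\<And>i. i \<in> S \<Longrightarrow> incongruent (I i) (X i)"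
    and coprime: "\<And>i j. i \<in> S \<Longrightarrow> j \<in> S \<Longrightarrow> i \<noteq> j \<Longrightarrow> \<exists>u. u \<in> I j \<and> 1 - u \<in> I i"
  obtains Y where "incongruent ((*) x ` OK) Y" "card Y = (\<Prod>i\<in>S. card (X i))"
proof -
  obtain u where u: "\<And>i j. i \<in> S \<Longrightarrow> j \<in> S \<Longrightarrow> i \<noteq> j \<Longrightarrow> u i j \<in> I j \<and> 1 - u i j \<in> I i"
    using coprime by metis
  have uO: "u i j \<in> OK" if "i \<in> S" "j \<in> S" "i \<noteq> j" for i j using u[OF that] ideal_OK[OF I(1)[OF that(2)]] by blast
  define e where "e i = (\<Prod>j\<in>S - {i}. u i j)" for i
  have eO: "e i \<in> OK" if "i \<in> S" for i unfolding e_def by (rule OK_prod) (use that uO in auto)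
  have e1: "e i - 1 \<in> I i" if i: "i \<in> S" for i
  proof -
    have "u i j - 1 \<in> I i" if "j \<in> S - {i}" for j
      using ideal_diff[OF I(1)[OF i] ideal_0[OF I(1)[OF i]], of "1 - u i j"] u[of i j] i that by auto
    then have "(\<Prod>j\<in>S - {i}. u i j) - (\<Prod>j\<in>S - {i}. 1) \<in> I i"
      by (intro prod_congruent[OF I(1)[OF i]] OK_1) (use uO i in auto)
    then show ?thesis by (simp add: e_def)
  qed
  have e0: "e i \<in> I j" if ij: "i \<in> S" "j \<in> S" "i \<noteq> j" for i j
  proof -
    have "e i = u i j * (\<Prod>l\<in>S - {i} - {j}. u i l)"
      unfolding e_def by (rule prod.remove) (use S ij in auto)
    then show ?thesis
      using ideal_mult'[OF I(1)[OF ij(2)] OK_prod, of "S - {i} - {j}" "u i" "u i j"] u[OF ij] uO ij(1) by auto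
  qed
  define y where "y f = (\<Sum>i\<in>S. e i * f i)" for f
  have fO: "f i \<in> OK" if "f \<in> Pi\<^sub>E S X" "i \<in> S" for f i
    using X(2)[OF that(2)] that by (auto simp: incongruent_def)
  have yf: "y f - f j \<in> I j" if f: "f \<in> Pi\<^sub>E S X" and j: "j \<in> S" for f j
  proof -
    have "y f = e j * f j + (\<Sum>i\<in>S - {j}. e i * f i)" unfolding y_def by (rule sum.remove[OF S j])
    then have "y f - f j = (e j - 1) * f j + (\<Sum>i\<in>S - {j}. e i * f i)" by (simp add: algebra_simps)
    also have "\<dots> \<in> I j"
      by (intro ideal_add[OF I(1)[OF j]] ideal_mult'[OF I(1)[OF j]] ideal_sum[OF I(1)[OF j]] e1 e0)
        (use f j fO in auto)
    finally show ?thesis .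
  qed
  have key: "f = g" if fg: "f \<in> Pi\<^sub>E S X" "g \<in> Pi\<^sub>E S X" and d: "y f - y g \<in> (*) x ` OK" for f g
  proof (rule PiE_ext[OF fg])
    fix j assume j: "j \<in> S"
    note Ij = I(1)[OF j]
    have "y f - y g \<in> I j" using d principal_subset[OF Ij I(2)[OF j]] by blast
    then have "(y f - y g) - (y f - f j) + (y g - g j) \<in> I j"
      using ideal_add[OF Ij ideal_diff[OF Ij _ yf[OF fg(1) j]] yf[OF fg(2) j]] by blast
    then show "f j = g j"
      using X(2)[OF j] PiE_mem[OF fg(1) j] PiE_mem[OF fg(2) j] by (simp add: incongruent_def)
  qed
  have xO: "x \<in> OK" if "S \<noteq> {}" using that I ideal_OK by blast
  show ?thesis
  proof
    show "incongruent ((*) x ` OK) (y ` Pi\<^sub>E S X)"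
      unfolding incongruent_def using key eO fO by (auto simp: y_def intro!: OK_closed)
    have "inj_on y (Pi\<^sub>E S X)"
    proof (rule inj_onI)
      fix f g assume fg: "f \<in> Pi\<^sub>E S X" "g \<in> Pi\<^sub>E S X" "y f = y g"
      then have "y f - y g \<in> (*) x ` OK" using OK_0 by (auto simp: image_iff)
      then show "f = g" using key fg by blast
    qed
    then have "card (y ` Pi\<^sub>E S X) = card (Pi\<^sub>E S X)" by (rule card_image)
    also have "\<dots> = (\<Prod>i\<in>S. card (X i))" by (rule card_PiE[OF S])
    finally show "card (y ` Pi\<^sub>E S X) = (\<Prod>i\<in>S. card (X i))" .
  qed
qed

section \<open>Norms of the places dividing an integer\<close>

definition places_at :: "complex \<Rightarrow> complex set set" where
  "places_at x = {P \<in> finite_places K. x \<in> P}"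

text \<open>For \<open>x\<close> in \<open>P\<close>, the norm of \<open>P\<close> raised to its
  exponent in \<open>x\<close> truncated at 2: only exponent 1 has to be told from larger
  ones.\<close>

definition norm_weight :: "complex \<Rightarrow> complex set \<Rightarrow> real" where
  "norm_weight x P = (if x \<in> ip P P then real (ideal_norm K P) ^ 2 else real (ideal_norm K P))"

text \<open>Chinese remaindering yields as many incongruent elements modulo \<open>x\<close> as the
  product on the left, and \<open>principal_index_bound\<close> limits their number.
  \<open>S\<close> is an arbitrary finite subset because finiteness of \<open>places_at x\<close> is
  deduced from this bound.\<close>

lemma norm_product_bound:
  obtains C where "C \<ge> 1"
    "\<And>x S. x \<in> OK \<Longrightarrow> x \<noteq> 0 \<Longrightarrow> finite S \<Longrightarrow> S \<subseteq> places_at x \<Longrightarrow>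
       prod (norm_weight x) S \<le> C * mahler x"
proof -
  obtain C where C: "C \<ge> 1" "\<And>x Y. x \<in> OK \<Longrightarrow> x \<noteq> 0 \<Longrightarrow> incongruent ((*) x ` OK) Y \<Longrightarrow>
       finite Y \<and> real (card Y) \<le> C * mahler x"
    using principal_index_bound by metis
  show ?thesis
  proof
    show "C \<ge> 1" by fact
    fix x S assume x: "x \<in> OK" "x \<noteq> 0" and S: "finite S" "S \<subseteq> places_at x"
    define I where "I P = (if x \<in> ip P P then ip P P else P)" for P
    define N where "N P = (if x \<in> ip P P then ideal_norm K P ^ 2 else ideal_norm K P)" for P
    have SP: "P \<in> finite_places K" "x \<in> P" if "P \<in> S" for P using that S(2) by (auto simp: places_at_def)
    have sq: "ip P P \<subseteq> P" if "P \<in> S" for P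
      using R.ideal_prod_inter[of P P] place_ideal[OF SP(1)[OF that]] by blast
    have "\<exists>Y. finite Y \<and> incongruent (I P) Y \<and> card Y = N P" if P: "P \<in> S" for P
    proof (cases "x \<in> ip P P")
      case True
      obtain Y where "finite Y" "incongruent (ip P P) Y" "card Y = ideal_norm K P ^ 2"
        using incongruent_square[OF SP(1)[OF P]] .
      then show ?thesis using True by (intro exI[of _ Y]) (simp add: I_def N_def)
    next
      case False
      obtain Y where "finite Y" "incongruent P Y" "card Y = ideal_norm K P"
        using norm_transversal[OF SP(1)[OF P]] by metis
      then show ?thesis using False by (intro exI[of _ Y]) (simp add: I_def N_def)
    qed
    then obtain X where X: "\<And>P. P \<in> S \<Longrightarrow> finite (X P) \<and> incongruent (I P) (X P) \<and> card (X P) = N P"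
      by metis
    obtain Y where Y: "incongruent ((*) x ` OK) Y" "card Y = (\<Prod>P\<in>S. card (X P))"
    proof (rule chinese_remainder_incongruent[OF S(1), of I x X])
      fix P assume P: "P \<in> S"
      show "is_ideal (I P)" using place_ideal[OF SP(1)[OF P]] R.ideal_prod_is_ideal by (simp add: I_def)
      show "x \<in> I P" using SP[OF P] by (simp add: I_def)
      show "finite (X P)" "incongruent (I P) (X P)" using X[OF P] by auto
      fix Q assume Q: "Q \<in> S" "P \<noteq> Q"
      obtain u where "u \<in> ip Q Q" "1 - u \<in> ip P P" using places_comaximal[OF SP(1)[OF P] SP(1)[OF Q(1)] Q(2)] .
      then show "\<exists>u. u \<in> I Q \<and> 1 - u \<in> I P" using sq[OF P] sq[OF Q(1)] unfolding I_def by auto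
    qed blast
    have "real (\<Prod>P\<in>S. N P) = real (card Y)" using Y(2) X by simp
    also have "\<dots> \<le> C * mahler x" using C(2)[OF x Y(1)] by blast
    finally show "prod (norm_weight x) S \<le> C * mahler x"
      by (simp add: N_def norm_weight_def if_distrib cong: if_cong)
  qed
qed

lemma place_norm_ge_2: "P \<in> places_at x \<Longrightarrow> real (ideal_norm K P) \<ge> 2"
  using norm_ge_2[of P] by (simp add: places_at_def)

lemma finite_places_at:
  assumes x: "x \<in> OK" "x \<noteq> 0"
  shows "finite (places_at x)"
proof (rule ccontr)
  assume inf: "infinite (places_at x)"
  obtain C where C: "\<And>S. finite S \<Longrightarrow> S \<subseteq> places_at x \<Longrightarrow>
       prod (norm_weight x) S \<le> C * mahler x"
    using norm_product_bound x by metis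
  obtain n where n: "C * mahler x < 2 ^ n" using real_arch_pow[of 2 "C * mahler x"] by auto
  obtain S where S: "finite S" "card S = n" "S \<subseteq> places_at x" using infinite_arbitrarily_large[OF inf] by blast
  have "(2::real) ^ n = (\<Prod>P\<in>S. 2)" using S by simp
  also have "\<dots> \<le> prod (norm_weight x) S"
  proof (rule prod_mono, safe)
    fix P assume "P \<in> S"
    then have "real (ideal_norm K P) \<ge> 2" using S(3) place_norm_ge_2 by blast
    moreover from this have "real (ideal_norm K P) \<le> real (ideal_norm K P) ^ 2"
      by (intro self_le_power) simp_all
    ultimately have "2 \<le> real (ideal_norm K P)" "2 \<le> real (ideal_norm K P) ^ 2" by linarith+
    then show "2 \<le> norm_weight x P" unfolding norm_weight_def by (simp only: if_split) blast
  qed simp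
  also have "\<dots> \<le> C * mahler x" by (rule C[OF S(1,3)])
  finally show False using n by simp
qed

text \<open>A place contains its norm, so all these places contain one factorial. The final count
  depends on this, since \<open>card\<close> is 0 on infinite sets.\<close>

lemma finite_bounded_norm: "finite {P \<in> finite_places K. real (ideal_norm K P) \<le> x}"
proof (rule finite_subset)
  let ?N = "nat \<lfloor>x\<rfloor>"
  show "finite (places_at (of_nat (fact ?N)))" by (rule finite_places_at[OF OK_of_nat]) simp
  show "{P \<in> finite_places K. real (ideal_norm K P) \<le> x} \<subseteq> places_at (of_nat (fact ?N))"
  proof safe
    fix P assume P: "P \<in> finite_places K" "real (ideal_norm K P) \<le> x"
    have "ideal_norm K P \<le> ?N" using P(2) by linarith
    then have "ideal_norm K P dvd fact ?N" using norm_ge_2[OF P(1)] by (intro dvd_fact) auto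
    then obtain t where "fact ?N = ideal_norm K P * t" by blast
    then have "(of_nat (fact ?N) :: complex) = of_nat (ideal_norm K P) * of_nat t" by (metis of_nat_mult)
    then have "of_nat (fact ?N) \<in> P"
      using ideal_mult'[OF place_ideal[OF P(1)] OK_of_nat norm_in_place[OF P(1)]] by metis
    then show "P \<in> places_at (of_nat (fact ?N))" using P(1) by (simp add: places_at_def)
  qed
qed

end

section \<open>The consequence of the \<open>abc\<close> conjecture\<close>

context galois_field
begin

lemma nf_degree_pos: "nf_degree K > 0"
proof -
  obtain S where S: "finite S" "cx_rat.span S = K" using rat_spanned by blast
  obtain B where B: "B \<subseteq> K" "cx_rat.independent B" "K \<subseteq> cx_rat.span B" "card B = cx_rat.dim K"
    using cx_rat.basis_exists by blast
  have "finite B" using cx_rat.independent_span_bound[OF S(1) B(2)] B(1) S(2) by blast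
  moreover have "B \<noteq> {}" using B(3) K_one by auto
  ultimately show ?thesis using B(4) by (simp add: nf_degree_def card_gt_0_iff flip: B(4))
qed

lemma conductor_le:
  assumes T: "finite T" "T \<subseteq> finite_places K"
    and x: "\<And>x. x \<in> {x1, x2, x3} \<Longrightarrow> x \<in> OK \<and> places_at x \<subseteq> T"
  shows "conductor K x1 x2 x3 \<le> (\<Prod>P\<in>T. real (ideal_norm K P)) powr (1 / real (nf_degree K))"
proof -
  let ?f = "\<lambda>P. real (ideal_norm K P) powr (1 / real (nf_degree K))"
  have "finite_abs K P x = 1" if "P \<in> finite_places K" "P \<notin> T" "x \<in> {x1, x2, x3}" for P x
    using finite_abs_unit[of P x] norm_ge_2[of P] that assms(3)[OF that(3)] by (auto simp: places_at_def)
  then have sub: "{P \<in> finite_places K. \<not> (finite_abs K P x1 = 1 \<and> finite_abs K P x2 = 1 \<and> finite_abs K P x3 = 1)} \<subseteq> T"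
    by blast
  have "conductor K x1 x2 x3 \<le> prod ?f T"
    unfolding conductor_def
  proof (rule prod_mono2[OF T(1) sub])
    fix P assume "P \<in> T - {P \<in> finite_places K. \<not> (finite_abs K P x1 = 1 \<and> finite_abs K P x2 = 1 \<and> finite_abs K P x3 = 1)}"
    then have "ideal_norm K P \<ge> 2" using T(2) norm_ge_2 by blast
    then show "1 \<le> ?f P" by (intro ge_one_powr_ge_zero) simp_all
  qed simp
  also have "\<dots> = (\<Prod>P\<in>T. real (ideal_norm K P)) powr (1 / real (nf_degree K))"
    by (rule prod_powr_distrib[symmetric])
  finally show ?thesis .
qed

text \<open>The entries 1 and \<open>a ^ n\<close> alone give the factors of the Mahler measure; the
  first entry can only increase the maximum.\<close>

lemma height_ge:
  assumes "a \<in> OK"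
  shows "(mahler a ^ n) powr (1 / real (nf_degree K)) \<le> height K x 1 (a ^ n)"
proof -
  let ?d = "1 / real (nf_degree K)"
  have aK: "a \<in> K" using OK_K assms by blast
  have "mahler (a ^ n) powr ?d = (\<Prod>\<sigma>\<in>E. max 1 (cmod (\<sigma> (a ^ n))) powr ?d)"
    unfolding mahler_def by (rule prod_powr_distrib)
  also have "\<dots> \<le> height K x 1 (a ^ n)"
    unfolding height_def
  proof (rule prod_mono, safe)
    fix \<sigma> assume \<sigma>: "\<sigma> \<in> E"
    have "max 1 (cmod (\<sigma> (a ^ n))) powr ?d \<le> max (1 powr ?d) (cmod (\<sigma> (a ^ n)) powr ?d)"
      by (auto simp: max_def)
    also have "\<dots> = max (infinite_abs K \<sigma> 1) (infinite_abs K \<sigma> (a ^ n))"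
      by (simp add: infinite_abs_def emb_1[OF \<sigma>])
    finally show "max 1 (cmod (\<sigma> (a ^ n))) powr ?d
        \<le> max (infinite_abs K \<sigma> x) (max (infinite_abs K \<sigma> 1) (infinite_abs K \<sigma> (a ^ n)))" by linarith
  qed simp
  finally show ?thesis by (simp add: mahler_power[OF aK])
qed

lemma coprime_ints_1: "x \<in> OK \<Longrightarrow> coprime_ints K x 1"
proof -
  assume x: "x \<in> OK"
  let ?I = "Idl\<^bsub>int_ring K\<^esub> {x, 1}"
  have I: "is_ideal ?I" using x OK_1 by (intro R.genideal_ideal) auto
  have "1 \<in> ?I" using R.genideal_self[of "{x, 1}"] x OK_1 by auto
  then have "?I = OK" using ideal_OK[OF I] ideal_mult[OF I] by force
  then show ?thesis using x OK_1 by (simp add: coprime_ints_def)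
qed

end

section \<open>Simple and multiple places of a power minus 1\<close>

locale wieferich_base = galois_field +
  fixes a :: complex
  assumes a_int: "a \<in> OK" and a_nz: "a \<noteq> 0" and a_not_root: "\<not> (\<exists>n > 0. a ^ n = 1)"
begin

abbreviation x :: "nat \<Rightarrow> complex" where "x n \<equiv> a ^ n - 1"

abbreviation lnorm :: "complex set \<Rightarrow> real" where "lnorm P \<equiv> ln (real (ideal_norm K P))"

definition simple_places :: "nat \<Rightarrow> complex set set" where
  "simple_places n = {P \<in> places_at (x n). x n \<notin> ip P P}"

definition multiple_places :: "nat \<Rightarrow> complex set set" where
  "multiple_places n = {P \<in> places_at (x n). x n \<in> ip P P}"

lemma ln_mahler_pos: "ln (mahler a) > 0"
  using kronecker_mahler_gt_1[OF a_int a_nz a_not_root] by simp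

lemma x_OK: "x n \<in> OK"
  using a_int by (intro OK_closed)

lemma x_nz: "n > 0 \<Longrightarrow> x n \<noteq> 0"
  using a_not_root by (metis right_minus_eq)

lemma finite_x: "n > 0 \<Longrightarrow> finite (places_at (x n))"
  using finite_places_at x_OK x_nz by blast

lemma lnorm_pos: "P \<in> places_at z \<Longrightarrow> lnorm P > 0"
  using place_norm_ge_2[of P z] by simp

lemma places_split:
  assumes "n > 0"
  shows "sum f (places_at (x n)) = sum f (simple_places n) + (sum f (multiple_places n) :: real)"
proof -
  have "places_at (x n) = simple_places n \<union> multiple_places n" "simple_places n \<inter> multiple_places n = {}"
    by (auto simp: simple_places_def multiple_places_def)
  then show ?thesis using finite_x[OF assms] by (metis finite_Un sum.union_disjoint)
qed

lemma weighted_norm_bound: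
  obtains c where "c \<ge> 0" "\<And>n. n > 0 \<Longrightarrow>
    sum lnorm (simple_places n) + 2 * sum lnorm (multiple_places n) \<le> c + real n * ln (mahler a)"
proof -
  obtain C where C: "C \<ge> 1" "\<And>z S. z \<in> OK \<Longrightarrow> z \<noteq> 0 \<Longrightarrow> finite S \<Longrightarrow> S \<subseteq> places_at z \<Longrightarrow>
       prod (norm_weight z) S \<le> C * mahler z"
    using norm_product_bound by metis
  show ?thesis
  proof
    show "ln C + real (card E) * ln 2 \<ge> 0" using C(1) by simp
    fix n :: nat assume n: "n > 0"
    have w: "norm_weight (x n) P > 0" if "P \<in> places_at (x n)" for P
      using place_norm_ge_2[OF that] by (auto simp: norm_weight_def)
    have "sum lnorm (simple_places n) + 2 * sum lnorm (multiple_places n) =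
        (\<Sum>P\<in>simple_places n. ln (norm_weight (x n) P)) + (\<Sum>P\<in>multiple_places n. ln (norm_weight (x n) P))"
      unfolding sum_distrib_left
      by (intro arg_cong2[of _ _ _ _ "(+)"] sum.cong refl)
        (auto simp: norm_weight_def simple_places_def multiple_places_def ln_realpow dest: place_norm_ge_2)
    also have "\<dots> = ln (prod (norm_weight (x n)) (places_at (x n)))"
      unfolding places_split[OF n, symmetric]
      by (rule ln_prod[OF finite_x[OF n], symmetric]) (metis w less_irrefl)
    also have "\<dots> \<le> ln (C * mahler (x n))"
    proof (subst ln_le_cancel_iff)
      show "0 < prod (norm_weight (x n)) (places_at (x n))" using w by (intro prod_pos) auto
      show "0 < C * mahler (x n)" using C(1) mahler_ge_1[of "x n"] by (intro mult_pos_pos) linarith+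
    qed (rule C(2)[OF x_OK x_nz[OF n] finite_x[OF n] subset_refl])
    also have "\<dots> \<le> ln (C * (2 ^ card E * mahler a ^ n))"
    proof (subst ln_le_cancel_iff)
      show "0 < C * mahler (x n)" using C(1) mahler_ge_1[of "x n"] by (intro mult_pos_pos) linarith+
      show "0 < C * (2 ^ card E * mahler a ^ n)"
        using C(1) mahler_ge_1[of a] by (intro mult_pos_pos zero_less_power) linarith+
      show "C * mahler (x n) \<le> C * (2 ^ card E * mahler a ^ n)"
        using C(1) mahler_power_diff_1[OF OK_K[OF a_int]] by (intro mult_left_mono) auto
    qed
    also have "\<dots> = ln C + real (card E) * ln 2 + real n * ln (mahler a)"
      using C(1) mahler_ge_1[of a] by (simp add: ln_mult ln_realpow)
    finally show "sum lnorm (simple_places n) + 2 * sum lnorm (multiple_places n)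
        \<le> ln C + real (card E) * ln 2 + real n * ln (mahler a)" .
  qed
qed

lemma abc_lower_bound:
  assumes abc: "abc_conjecture K"
  obtains c where "\<And>n. n > 0 \<Longrightarrow>
    real n * ln (mahler a) \<le> c + 4/3 * (sum lnorm (simple_places n) + sum lnorm (multiple_places n))"
proof -
  let ?d = "real (nf_degree K)"
  have d: "?d > 0" using nf_degree_pos by simp
  obtain C where C: "\<And>\<alpha> \<beta>. \<alpha> \<in> K \<Longrightarrow> \<beta> \<in> K \<Longrightarrow> \<alpha> \<noteq> 0 \<Longrightarrow> \<beta> \<noteq> 0 \<Longrightarrow> \<alpha> + \<beta> \<noteq> 0 \<Longrightarrow>
      coprime_ints K \<alpha> \<beta> \<Longrightarrow> height K \<alpha> \<beta> (\<alpha> + \<beta>) \<le> C * conductor K \<alpha> \<beta> (\<alpha> + \<beta>) powr (1 + 1/3)"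
    using abc[unfolded abc_conjecture_def, rule_format, of "1/3"] by auto
  show ?thesis
  proof
    fix n :: nat assume n: "n > 0"
    \<comment> \<open>The places of \<open>a ^ n\<close> are among those of \<open>a\<close>, which
      do not vary with \<open>n\<close> and end up in the constant.\<close>
    define T where "T = places_at (x n) \<union> places_at a"
    define W where "W = (\<Prod>P\<in>T. real (ideal_norm K P))"
    have T: "finite T" "T \<subseteq> finite_places K"
      using finite_x[OF n] finite_places_at[OF a_int a_nz] by (auto simp: T_def places_at_def)
    have T2: "real (ideal_norm K P) \<ge> 2" if "P \<in> T" for P
      using that place_norm_ge_2 by (auto simp: T_def)
    have W1: "W \<ge> 1" unfolding W_def using T2 by (intro prod_ge_1) force
    have "places_at (a ^ n) \<subseteq> T" "places_at 1 \<subseteq> T"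
      using place_power[of _ a n] a_int place_1 by (auto simp: places_at_def T_def)
    then have cond: "conductor K (x n) 1 (a ^ n) \<le> W powr (1 / ?d)"
      unfolding W_def by (intro conductor_le T) (auto simp: OK_1 x_OK OK_power a_int T_def)
    have cond0: "0 \<le> conductor K (x n) 1 (a ^ n)" unfolding conductor_def by (intro prod_nonneg) auto
    have "height K (x n) 1 (x n + 1) \<le> C * conductor K (x n) 1 (x n + 1) powr (1 + 1/3)"
      by (rule C) (use OK_K[OF x_OK] K_one x_nz[OF n] a_nz coprime_ints_1[OF x_OK] in auto)
    then have "height K (x n) 1 (a ^ n) \<le> C * conductor K (x n) 1 (a ^ n) powr (4/3)" by simp
    then have h: "(mahler a ^ n) powr (1 / ?d) \<le> C * conductor K (x n) 1 (a ^ n) powr (4/3)"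
      using height_ge[OF a_int, of n "x n"] by linarith
    have pos: "(mahler a ^ n) powr (1 / ?d) > 0" using mahler_ge_1[of a] by (intro powr_gt_zero[THEN iffD2]) auto
    \<comment> \<open>The conjecture does not state a sign for \<open>C\<close>; positivity of the
      height forces it, and logarithms need it.\<close>
    have Cpos: "C > 0"
    proof (rule ccontr)
      assume "\<not> C > 0"
      then have "C * conductor K (x n) 1 (a ^ n) powr (4/3) \<le> 0" by (intro mult_nonpos_nonneg) auto
      then show False using h pos by linarith
    qed
    have "(mahler a ^ n) powr (1 / ?d) \<le> C * (W powr (1 / ?d)) powr (4/3)"
      using h mult_left_mono[OF powr_mono2[OF _ cond0 cond, of "4/3"], of C] Cpos by linarith
    then have "ln ((mahler a ^ n) powr (1 / ?d)) \<le> ln (C * (W powr (1 / ?d)) powr (4/3))"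
      using pos W1 Cpos by (subst ln_le_cancel_iff) auto
    then have "real n * ln (mahler a) / ?d \<le> ln C + 4/3 * (ln W / ?d)"
      using W1 Cpos mahler_ge_1[of a] by (simp add: ln_mult ln_powr ln_realpow)
    then have "real n * ln (mahler a) \<le> ?d * ln C + 4/3 * ln W"
      using d by (simp add: field_simps)
    moreover have "ln W = sum lnorm T"
      unfolding W_def using T2 by (intro ln_prod T(1)) force
    moreover have "sum lnorm T \<le> sum lnorm (places_at (x n)) + sum lnorm (places_at a)"
    proof -
      have "0 \<le> sum lnorm (places_at (x n) \<inter> places_at a)"
        by (intro sum_nonneg) (meson IntD1 lnorm_pos less_imp_le)
      then show ?thesis
        unfolding T_def using sum_Un[OF finite_x[OF n] finite_places_at[OF a_int a_nz], of lnorm] by simp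
    qed
    ultimately have "real n * ln (mahler a) \<le> ?d * ln C + 4/3 * (sum lnorm (places_at (x n)) + sum lnorm (places_at a))"
      by argo
    then show "real n * ln (mahler a) \<le> (?d * ln C + 4/3 * sum lnorm (places_at a))
        + 4/3 * (sum lnorm (simple_places n) + sum lnorm (multiple_places n))"
      unfolding places_split[OF n] by (simp add: algebra_simps)
  qed
qed

lemma simple_places_lower_bound:
  assumes abc: "abc_conjecture K"
  obtains c where "\<And>n. n > 0 \<Longrightarrow> sum lnorm (simple_places n) \<ge> real n * ln (mahler a) / 2 - c"
proof -
  obtain c1 where c1: "\<And>n. n > 0 \<Longrightarrow>
      sum lnorm (simple_places n) + 2 * sum lnorm (multiple_places n) \<le> c1 + real n * ln (mahler a)"
    using weighted_norm_bound by metis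
  obtain c2 where c2: "\<And>n. n > 0 \<Longrightarrow>
      real n * ln (mahler a) \<le> c2 + 4/3 * (sum lnorm (simple_places n) + sum lnorm (multiple_places n))"
    using abc_lower_bound[OF abc] by metis
  show ?thesis
  proof
    fix n :: nat assume n: "n > 0"
    \<comment> \<open>Take 3/2 times the second inequality and subtract the first: the multiple
      places cancel.\<close>
    show "sum lnorm (simple_places n) \<ge> real n * ln (mahler a) / 2 - (3/2 * c2 + c1)"
      using c1[OF n] c2[OF n] by argo
  qed
qed

end

text \<open>Some prime \<open>l\<close> has smaller multiplicity in \<open>m\<close> than in
  \<open>k\<close>. In the cofactor of \<open>m\<close> its multiplicity is then at least
  \<open>(N - 1) * multiplicity l k + 1\<close>, which is at least \<open>N\<close>.\<close>

lemma prime_power_dvd_cofactor: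
  fixes k q m N :: nat
  assumes m: "m dvd k ^ N * q" and "\<not> k dvd m" "k > 0" "q > 0" "N > 0"
  obtains l where "Factorial_Ring.prime l" "l dvd k" "l ^ N dvd k ^ N * q" "m dvd k ^ N * q div l ^ N"
proof -
  let ?n = "k ^ N * q"
  have n: "?n > 0" using assms by simp
  obtain t where t: "?n = m * t" using m by blast
  then have mt: "m > 0" "t > 0" using n by (metis gr0I mult_0 mult_0_right less_irrefl)+
  obtain l where l: "Factorial_Ring.prime l" "multiplicity l m < multiplicity l k"
    using multiplicity_le_imp_dvd[of k m] assms(2,3) by (metis not_less less_irrefl)
  have "multiplicity l ?n = N * multiplicity l k + multiplicity l q"
    using l(1) assms by (simp add: prime_elem_multiplicity_mult_distrib prime_elem_multiplicity_power_distrib)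
  moreover have "multiplicity l ?n = multiplicity l m + multiplicity l t"
    unfolding t using l(1) mt by (simp add: prime_elem_multiplicity_mult_distrib)
  moreover obtain N' where N': "N = Suc N'" using assms(5) by (cases N) auto
  moreover have "N * multiplicity l k = multiplicity l k + N' * multiplicity l k" by (simp add: N')
  moreover have "N' \<le> N' * multiplicity l k" using l(2) by (cases "multiplicity l k") auto
  ultimately have "N \<le> multiplicity l t" using l(2) by linarith
  then have lt: "l ^ N dvd t" using multiplicity_dvd' by blast
  then obtain s where s: "t = l ^ N * s" by blast
  have "l > 0" using l(1) prime_gt_0_nat by blast
  show ?thesis
  proof
    show "Factorial_Ring.prime l" by (rule l)
    show "l dvd k" using l(2) not_dvd_imp_multiplicity_0[of l k] by (metis not_less_zero)
    show "l ^ N dvd ?n" unfolding t s by simp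
    have "?n div l ^ N = m * s" unfolding t s using \<open>l > 0\<close> by (simp add: mult.left_commute)
    then show "m dvd ?n div l ^ N" by simp
  qed
qed

section \<open>Places of prescribed order\<close>

lemma sum_UN_le:
  fixes f :: "'a \<Rightarrow> real"
  assumes "finite I" "\<And>i. i \<in> I \<Longrightarrow> finite (B i)" "\<And>i z. i \<in> I \<Longrightarrow> z \<in> B i \<Longrightarrow> f z \<ge> 0"
  shows "sum f (\<Union>i\<in>I. B i) \<le> (\<Sum>i\<in>I. sum f (B i))"
  using assms
proof (induction rule: finite_induct)
  case (insert i I)
  have "sum f (B i \<union> (\<Union>i\<in>I. B i)) \<le> sum f (B i) + sum f (\<Union>i\<in>I. B i)"
  proof -
    have "finite (\<Union>i\<in>I. B i)" "finite (B i)" using insert by auto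
    moreover have "0 \<le> sum f (B i \<inter> (\<Union>i\<in>I. B i))" using insert.prems by (intro sum_nonneg) auto
    ultimately show ?thesis using sum_Un[of "B i" "\<Union>i\<in>I. B i" f] by simp
  qed
  moreover have "sum f (\<Union>i\<in>I. B i) \<le> (\<Sum>i\<in>I. sum f (B i))"
    by (rule insert.IH) (use insert.prems in blast)+
  ultimately show ?case using insert.hyps by simp
qed simp

context wieferich_base
begin

lemma sum_lnorm_le:
  obtains c where "c \<ge> 0" "\<And>n. n > 0 \<Longrightarrow> sum lnorm (places_at (x n)) \<le> c + real n * ln (mahler a)"
proof -
  obtain c where c: "c \<ge> 0" "\<And>n. n > 0 \<Longrightarrow>
      sum lnorm (simple_places n) + 2 * sum lnorm (multiple_places n) \<le> c + real n * ln (mahler a)"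
    using weighted_norm_bound by metis
  show ?thesis
  proof
    show "c \<ge> 0" by fact
    fix n :: nat assume n: "n > 0"
    have "0 \<le> sum lnorm (multiple_places n)"
      by (intro sum_nonneg less_imp_le lnorm_pos) (auto simp: multiple_places_def)
    then show "sum lnorm (places_at (x n)) \<le> c + real n * ln (mahler a)"
      using c(2)[OF n] places_split[OF n, of lnorm] by linarith
  qed
qed

text \<open>If \<open>k\<close> divides the order, then \<open>q\<close> does not, and the order
  divides \<open>k ^ N\<close>. Otherwise \<open>prime_power_dvd_cofactor\<close> applies to the
  order.\<close>

lemma places_of_small_order:
  assumes q: "Factorial_Ring.prime q" and k: "k > 0" and N: "N > 0"
    and P: "P \<in> places_at (x (k ^ N * q))"
    and small: "\<not> (k dvd place_ord P a \<and> q dvd place_ord P a)"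
  shows "P \<in> places_at (x (k ^ N)) \<union>
    (\<Union>l \<in> {l. Factorial_Ring.prime l \<and> l dvd k \<and> l ^ N dvd k ^ N * q}. places_at (x (k ^ N * q div l ^ N)))"
proof -
  have q0: "q > 0" using q prime_gt_0_nat by blast
  have n0: "k ^ N * q > 0" using k q0 by simp
  have fp: "P \<in> finite_places K" "x (k ^ N * q) \<in> P" using P by (auto simp: places_at_def)
  note ord = place_ord[OF fp(1) a_int n0 fp(2)]
  let ?m = "place_ord P a"
  have dvd: "?m dvd k ^ N * q" using ord(3) fp(2) by blast
  show ?thesis
  proof (cases "k dvd ?m")
    case True
    then have "coprime q ?m" using small q prime_imp_coprime by blast
    then have "?m dvd k ^ N" using dvd coprime_dvd_mult_left_iff[of ?m q "k ^ N"] by (simp add: coprime_commute)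
    then have "x (k ^ N) \<in> P" using ord(3) by blast
    then show ?thesis using fp(1) by (simp add: places_at_def)
  next
    case False
    obtain l where l: "Factorial_Ring.prime l" "l dvd k" "l ^ N dvd k ^ N * q" "?m dvd k ^ N * q div l ^ N"
      using prime_power_dvd_cofactor[OF dvd False k q0 N] .
    then have "x (k ^ N * q div l ^ N) \<in> P" using ord(3) by blast
    then have "P \<in> places_at (x (k ^ N * q div l ^ N))" using fp(1) by (simp add: places_at_def)
    then show ?thesis using l by blast
  qed
qed

lemma primitive_place_exists:
  assumes abc: "abc_conjecture K" and k: "k > 0"
  obtains N q0 c where "c \<ge> 1" "\<And>q. Factorial_Ring.prime q \<Longrightarrow> q \<ge> q0 \<Longrightarrow>
    \<exists>P. non_wieferich_place K a P \<and> lnorm P \<le> c * real q \<and> [ideal_norm K P = 1] (mod k) \<and>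
        q dvd place_ord P a \<and> place_ord P a dvd k ^ N * q"
proof -
  define L where "L = ln (mahler a)"
  have L: "L > 0" unfolding L_def by (rule ln_mahler_pos)
  obtain c1 where c1: "c1 \<ge> 0" "\<And>n. n > 0 \<Longrightarrow> sum lnorm (places_at (x n)) \<le> c1 + real n * L"
    using sum_lnorm_le unfolding L_def by metis
  obtain c2 where c2: "\<And>n. n > 0 \<Longrightarrow> sum lnorm (simple_places n) \<ge> real n * L / 2 - c2"
    using simple_places_lower_bound[OF abc] unfolding L_def by metis
  define N where "N = k + 2"
  \<comment> \<open>Collects all terms that do not depend on \<open>q\<close>: too few good places
    would give \<open>n * L / 4 \<le> D\<close>, which \<open>q0\<close> excludes because
    \<open>q \<le> n\<close>.\<close>
  define D where "D = c2 + (1 + real k) * c1 + real (k ^ N) * L"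
  define q0 where "q0 = nat \<lceil>4 * D / L\<rceil> + 1"
  define c where "c = max 1 (c1 + real (k ^ N) * L)"
  show ?thesis
  proof
    show "c \<ge> 1" by (simp add: c_def)
    fix q assume q: "Factorial_Ring.prime q" "q \<ge> q0"
    have qpos: "q > 0" using q(1) prime_gt_0_nat by blast
    define n where "n = k ^ N * q"
    have n: "n > 0" using k qpos by (simp add: n_def)
    have "\<exists>P\<in>simple_places n. k dvd place_ord P a \<and> q dvd place_ord P a"
    proof (rule ccontr)
      assume none: "\<not> ?thesis"
      define I where "I = {l. Factorial_Ring.prime l \<and> l dvd k \<and> l ^ N dvd n}"
      have Ik: "I \<subseteq> {1..k}" using k by (auto simp: I_def dest: dvd_imp_le prime_gt_0_nat)
      then have finI: "finite I" using finite_subset by blast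
      have cardI: "real (card I) \<le> real k" using card_mono[OF _ Ik] by simp
      have pos: "n div l ^ N > 0" if "l \<in> I" for l
      proof -
        have "l ^ N \<le> n" using that n by (intro dvd_imp_le) (auto simp: I_def)
        then show ?thesis using that prime_gt_0_nat by (auto simp: I_def div_greater_zero_iff)
      qed
      let ?U = "\<Union>l\<in>I. places_at (x (n div l ^ N))"
      have finU: "finite ?U" using finI finite_x pos by blast
      have kN: "k ^ N > 0" using k by simp
      have "simple_places n \<subseteq> places_at (x (k ^ N)) \<union> ?U"
      proof
        fix P assume P: "P \<in> simple_places n"
        then have "P \<in> places_at (x (k ^ N * q))" by (simp add: simple_places_def n_def)
        then show "P \<in> places_at (x (k ^ N)) \<union> ?U"
          using places_of_small_order[OF q(1) k, of N P] none P unfolding I_def n_def N_def by auto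
      qed
      then have "sum lnorm (simple_places n) \<le> sum lnorm (places_at (x (k ^ N)) \<union> ?U)"
      proof (rule sum_mono2[rotated])
        show "finite (places_at (x (k ^ N)) \<union> ?U)" using finU finite_x[OF kN] by blast
        show "0 \<le> lnorm P" if "P \<in> (places_at (x (k ^ N)) \<union> ?U) - simple_places n" for P
          using that lnorm_pos less_imp_le by blast
      qed
      also have "\<dots> \<le> sum lnorm (places_at (x (k ^ N))) + sum lnorm ?U"
      proof -
        have "0 \<le> sum lnorm (places_at (x (k ^ N)) \<inter> ?U)"
          by (intro sum_nonneg) (meson IntD1 lnorm_pos less_imp_le)
        then show ?thesis using sum_Un[OF finite_x[OF kN] finU, of lnorm] by simp
      qed
      also have "sum lnorm (places_at (x (k ^ N))) \<le> c1 + real (k ^ N) * L" by (rule c1(2)[OF kN])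
      also have "sum lnorm ?U \<le> (\<Sum>l\<in>I. sum lnorm (places_at (x (n div l ^ N))))"
        by (rule sum_UN_le[OF finI]) (use pos finite_x lnorm_pos less_imp_le in blast)+
      also have "\<dots> \<le> (\<Sum>l\<in>I. c1 + real n / 2 ^ N * L)"
      proof (rule sum_mono)
        fix l assume l: "l \<in> I"
        have "2 \<le> l" using l prime_ge_2_nat by (simp add: I_def)
        then have "(2::real) ^ N \<le> real l ^ N" by (intro power_mono) auto
        then have "real n / real l ^ N \<le> real n / 2 ^ N" using \<open>2 \<le> l\<close> by (intro divide_left_mono) auto
        moreover have "real (n div l ^ N) = real n / real l ^ N"
          using l by (simp add: I_def real_of_nat_div)
        ultimately have "real (n div l ^ N) * L \<le> real n / 2 ^ N * L" using L by (intro mult_right_mono) auto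
        then show "sum lnorm (places_at (x (n div l ^ N))) \<le> c1 + real n / 2 ^ N * L"
          using c1(2)[OF pos[OF l]] by linarith
      qed
      also have "\<dots> = real (card I) * (c1 + real n / 2 ^ N * L)" by simp
      also have "\<dots> \<le> real k * (c1 + real n / 2 ^ N * L)"
        using cardI c1(1) L by (intro mult_right_mono) auto
      also have "\<dots> = real k * c1 + real k / 2 ^ N * (real n * L)" by (simp add: algebra_simps)
      also have "\<dots> \<le> real k * c1 + 1/4 * (real n * L)"
      proof -
        have "real k \<le> 2 ^ k" using less_exp[of k] by (metis less_imp_le of_nat_le_iff of_nat_numeral of_nat_power)
        then have "real k / 2 ^ N \<le> 1/4" by (simp add: N_def field_simps)
        then have "real k / 2 ^ N * (real n * L) \<le> 1/4 * (real n * L)" using L by (intro mult_right_mono) auto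
        then show ?thesis by simp
      qed
      finally have "real n * L / 2 - c2 \<le> c1 + real (k ^ N) * L + (real k * c1 + 1/4 * (real n * L))"
        using c2[OF n] by linarith
      then have "real n * L / 4 \<le> D" by (simp add: D_def algebra_simps)
      moreover have "q \<le> n" using k by (simp add: n_def)
      then have "real q * L \<le> real n * L" using L by (intro mult_right_mono) simp_all
      ultimately have "real q * L \<le> 4 * D" by linarith
      then have "real q \<le> 4 * D / L" using L by (simp add: field_simps)
      then show False using q(2) unfolding q0_def by linarith
    qed
    then obtain P where P: "P \<in> simple_places n" "k dvd place_ord P a" "q dvd place_ord P a" by blast
    have fp: "P \<in> finite_places K" "x n \<in> P" "x n \<notin> ip P P"
      using P(1) by (auto simp: simple_places_def places_at_def)
    note ord = place_ord[OF fp(1) a_int n fp(2)]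
    have "non_wieferich_place K a P" by (rule non_wieferich_criterion[OF fp(1) a_int n fp(2,3)])
    moreover have "lnorm P \<le> c * real q"
    proof -
      have "lnorm P \<le> sum lnorm (places_at (x n))"
        using P(1) finite_x[OF n] by (intro member_le_sum) (auto simp: simple_places_def intro: less_imp_le lnorm_pos)
      also have "\<dots> \<le> c1 + real n * L" by (rule c1(2)[OF n])
      also have "\<dots> \<le> (c1 + real (k ^ N) * L) * real q"
        using c1(1) qpos mult_left_mono[of 1 "real q" c1] by (simp add: n_def algebra_simps)
      also have "\<dots> \<le> c * real q" by (intro mult_right_mono) (auto simp: c_def)
      finally show ?thesis .
    qed
    moreover have "[ideal_norm K P = 1] (mod k)"
    proof -
      have "k dvd ideal_norm K P - 1" using place_ord_dvd_norm[OF fp(1) a_int n fp(2)] P(2) dvd_trans by blast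
      then have "[ideal_norm K P - 1 + 1 = 0 + 1] (mod k)" by (intro cong_add) (auto simp: cong_0_iff)
      then show ?thesis using norm_ge_2[OF fp(1)] by simp
    qed
    moreover have "place_ord P a dvd k ^ N * q" using ord(3) fp(2) by (simp add: n_def)
    ultimately show "\<exists>P. non_wieferich_place K a P \<and> lnorm P \<le> c * real q \<and> [ideal_norm K P = 1] (mod k) \<and>
        q dvd place_ord P a \<and> place_ord P a dvd k ^ N * q"
      using P(3) by blast
  qed
qed

end

theorem theorem1:
  fixes K :: "complex set" and \<epsilon> :: real and k :: nat and a :: complex
  assumes "number_field K" and "galois K"
    and "\<epsilon> > 0" and "k > 0"
    and "a \<in> carrier (int_ring K)" and "a \<noteq> 0"
    and "\<not> (\<exists>n > 0. a ^ n = 1)"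
    and "abc_conjecture K"
  shows "\<exists>c > 0. \<forall>\<^sub>F x :: real in at_top.
           real (card {P. non_wieferich_place K a P \<and> real (ideal_norm K P) \<le> x \<and>
                          [ideal_norm K P = 1] (mod k)})
             \<ge> c * (ln x / ln (ln x))"
proof -
  interpret wieferich_base K a
    using assms by unfold_locales simp_all
  obtain N q0 c where c: "c \<ge> 1" and ex: "\<And>q. Factorial_Ring.prime q \<Longrightarrow> q \<ge> q0 \<Longrightarrow>
    \<exists>P. non_wieferich_place K a P \<and> ln (real (ideal_norm K P)) \<le> c * real q \<and> [ideal_norm K P = 1] (mod k) \<and>
        q dvd place_ord P a \<and> place_ord P a dvd k ^ N * q"
    using primitive_place_exists[OF assms(8,4)] by metis
  define p where "p q = (SOME P. non_wieferich_place K a P \<and> ln (real (ideal_norm K P)) \<le> c * real q \<and>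
    [ideal_norm K P = 1] (mod k) \<and> q dvd place_ord P a \<and> place_ord P a dvd k ^ N * q)" for q
  have p: "non_wieferich_place K a (p q)" "ln (real (ideal_norm K (p q))) \<le> c * real q"
      "[ideal_norm K (p q) = 1] (mod k)" "q dvd place_ord (p q) a" "place_ord (p q) a dvd k ^ N * q"
    if "Factorial_Ring.prime q" "q \<ge> q0" for q
    using someI_ex[OF ex[OF that]] unfolding p_def by blast+
  \<comment> \<open>Primes above \<open>k\<close> do not divide \<open>k ^ N\<close>, so the order
    at the chosen place determines the prime.\<close>
  define q1 where "q1 = max q0 (k + 1)"
  define A where "A X = {P. non_wieferich_place K a P \<and> real (ideal_norm K P) \<le> X \<and> [ideal_norm K P = 1] (mod k)}"
    for X
  have finA: "finite (A X)" for X
    by (rule finite_subset[OF _ finite_bounded_norm[of X]]) (auto simp: A_def non_wieferich_place_def)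
  have inj: "inj_on p {q. Factorial_Ring.prime q \<and> q \<ge> q1}"
  proof (rule inj_onI, safe)
    fix q r assume q: "Factorial_Ring.prime q" "q \<ge> q1" and r: "Factorial_Ring.prime r" "r \<ge> q1" and eq: "p q = p r"
    have "q \<ge> q0" "r \<ge> q0" using q(2) r(2) by (simp_all add: q1_def)
    then have "r dvd place_ord (p q) a" "place_ord (p q) a dvd k ^ N * q"
      using p(4)[OF r(1)] p(5)[OF q(1)] unfolding eq by blast+
    then have "r dvd k ^ N * q" by (rule dvd_trans)
    then have "r dvd k ^ N \<or> r dvd q" by (simp only: prime_dvd_mult_iff[OF r(1)])
    moreover have "\<not> r dvd k ^ N"
      using prime_dvd_power[OF r(1), of k N] dvd_imp_le[of r k] assms(4) r(2) by (auto simp: q1_def)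
    ultimately show "q = r" using primes_dvd_imp_eq[OF r(1) q(1)] by blast
  qed
  have count: "real (card {q. Factorial_Ring.prime q \<and> q \<le> M}) - real q1 \<le> real (card (A X))"
    if M: "c * real M \<le> ln X" and X: "X > 0" for M X
  proof -
    let ?Q = "{q. Factorial_Ring.prime q \<and> q \<le> M}"
    have "p ` (?Q - {..<q1}) \<subseteq> A X"
    proof (rule image_subsetI)
      fix q assume "q \<in> ?Q - {..<q1}"
      then have q: "Factorial_Ring.prime q" "q \<le> M" "q \<ge> q1" by auto
      then have q0: "q \<ge> q0" by (simp add: q1_def)
      have "c * real q \<le> c * real M" using q c by (intro mult_left_mono) auto
      then have "ln (real (ideal_norm K (p q))) \<le> ln X" using p(2)[OF q(1) q0] M by linarith
      moreover have "real (ideal_norm K (p q)) > 0"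
        using p(1)[OF q(1) q0] norm_ge_2[of "p q"] by (simp add: non_wieferich_place_def)
      ultimately have "real (ideal_norm K (p q)) \<le> X" using X by simp
      then show "p q \<in> A X" using p[OF q(1) q0] by (simp add: A_def)
    qed
    moreover have "inj_on p (?Q - {..<q1})" by (rule inj_on_subset[OF inj]) auto
    ultimately have "card (?Q - {..<q1}) \<le> card (A X)" using card_inj_on_le finA by blast
    moreover have "card ?Q - card {..<q1} \<le> card (?Q - {..<q1})" by (rule diff_card_le_card_Diff) simp
    ultimately show ?thesis by simp
  qed
  \<comment> \<open>The bound of \<open>chebyshev_lower\<close> at \<open>M\<close> is at least 2
    \<delta> times the target; half of it absorbs the at most \<open>q1\<close> discarded
    primes.\<close>
  define \<delta> where "\<delta> = ln 2 / (8 * c)"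
  have \<delta>: "\<delta> > 0" using c by (simp add: \<delta>_def)
  have "filterlim (\<lambda>X::real. ln X / ln (ln X)) at_top at_top" by real_asymp
  then have "\<forall>\<^sub>F X::real in at_top. real q1 / \<delta> \<le> ln X / ln (ln X)" by (simp add: filterlim_at_top)
  moreover have "filterlim (\<lambda>X::real. ln X) at_top at_top" by (rule ln_at_top)
  \<comment> \<open>Makes \<open>y\<close> at least 2, so that \<open>M\<close> is at least 2 and
    rounding loses at most half of \<open>y\<close>.\<close>
  then have "\<forall>\<^sub>F X::real in at_top. 2 * c + 2 \<le> ln X" by (simp add: filterlim_at_top)
  moreover have "\<forall>\<^sub>F X::real in at_top. X > 0" by (rule eventually_gt_at_top)
  ultimately have "\<forall>\<^sub>F X::real in at_top. \<delta> * (ln X / ln (ln X)) \<le> real (card (A X))"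
  proof eventually_elim
    case (elim X)
    define t where "t = ln X"
    define y where "y = t / c"
    \<comment> \<open>The largest \<open>M\<close> with \<open>c * real M \<le> ln X\<close>, so
      every admissible prime up to \<open>M\<close> yields a place of norm at most
      \<open>X\<close>.\<close>
    define M where "M = nat \<lfloor>y\<rfloor>"
    have t: "t \<ge> 2 * c + 2" using elim by (simp add: t_def)
    then have y: "y \<ge> 2" using c by (simp add: y_def field_simps)
    then have M: "M \<ge> 2" "real M \<le> y" "real M \<ge> y / 2" unfolding M_def by linarith+
    have "c * real M \<le> t" using M(2) c by (simp add: y_def field_simps)
    then have *: "real (card {q. Factorial_Ring.prime q \<and> q \<le> M}) - real q1 \<le> real (card (A X))"
      using count elim by (simp add: t_def)
    have "y \<le> t" using c t by (simp add: y_def field_simps)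
    then have "ln (real M) \<le> ln t" using M by (subst ln_le_cancel_iff) auto
    moreover have "ln (real M) > 0" using M(1) by simp
    ultimately have "y / 2 / ln t \<le> real M / ln (real M)" using M(3) y by (intro frac_le) auto
    then have "ln 2 / 2 * (y / 2 / ln t) \<le> ln 2 / 2 * (real M / ln (real M))" by (intro mult_left_mono) auto
    also have "\<dots> \<le> real (card {q. Factorial_Ring.prime q \<and> q \<le> M})" by (rule chebyshev_lower[OF M(1)])
    finally have "2 * (\<delta> * (t / ln t)) - real q1 \<le> real (card (A X))"
      using * by (simp add: \<delta>_def y_def field_simps)
    moreover have "real q1 \<le> \<delta> * (t / ln t)" using elim(1) \<delta> by (simp add: t_def field_simps)
    ultimately show ?case by (simp add: t_def)
  qed
  then show ?thesis using \<delta> unfolding A_def by blast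
qed

end
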